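(* For every $n\ge1$ and $p\ge0$ there is an isomorphism of $\mathfrak{S}_n\times\mathrm{SL}_2(\mathbb{Q})$-representations \[E_3^{p,0}(n,E)\cong \textstyle\bigwedge^p V(1)\boxtimes \mathbb{V}_p,\] and $\dim_{\mathbb{Q}}E_3^{p,0}(n,E)=\binom{n-1}{p}(p+1)$.
   Context: Let $E$ be a complex elliptic curve, $x,y$ a basis of $H^1(E;\mathbb{Q})$ with $xy$ generating $H^2$. Let $E_2(n)$ be the bigraded algebra over $\mathbb{Q}$ (second page of the rational Leray spectral sequence of the inclusion into $E^n$ of the configuration space of $n$ distinct ordered points of $E$) obtained as the quotient of the free graded-commutative algebra (for total degree) on $x_i,y_i$ ($1\le i\le n$) of bidegree $(1,0)$ and $\omega_{ij}=\omega_{ji}$ ($i\ne j$) of bidegree $(0,1)$ by the relations $(x_i-x_j)\omega_{ij}=0$, $(y_i-y_j)\omega_{ij}=0$, $\omega_{ij}\omega_{jk}+\omega_{jk}\omega_{ki}+\omega_{ki}\omega_{ij}=0$ (distinct $i,j,k$), with differential $d_2$ of bidegree $(2,-1)$, a derivation for total degree, $d_2x_i=d_2y_i=0$, $d_2\omega_{ij}=(x_i-x_j)(y_i-y_j)$. Let $E_2(n,E)$ be the sub-differential bigraded algebra generated by the $x_i-x_j$, $y_i-y_j$, $\omega_{ij}$ (the $E_2$ page for the quotient of the configuration space by diagonal translation by $E$), and $E_3^{p,q}(n,E)$ the cohomology of $(E_2(n,E),d_2)$ in bidegree $(p,q)$. The symmetric group $\mathfrak{S}_n$ acts by permuting indices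 ($\sigma x_i=x_{\sigma(i)}$, $\sigma y_i=y_{\sigma(i)}$, $\sigma\omega_{ij}=\omega_{\sigma(i)\sigma(j)}$); $\mathrm{SL}_2(\mathbb{Q})$ acts via its standard representation on each pair $(x_i,y_i)$ as on $(x,y)$ and trivially on the $\omega_{ij}$. These actions commute with $d_2$. $V(1)$ denotes the standard $(n-1)$-dimensional irreducible representation of $\mathfrak{S}_n$ and $\mathbb{V}_p$ the irreducible $(p+1)$-dimensional representation of $\mathrm{SL}_2(\mathbb{Q})$. *)

theory Defs
  imports Complex_Main "HOL-Library.Function_Algebras" "HOL-Library.Product_Lexorder"
          "HOL-Combinatorics.Permutations"
begin

text \<open>Generators of the free graded-commutative algebra.  Indices are 0,...,n-1.
  A generator is a triple: (0,i,0) is x_i, (1,i,0) is y_i, (2,i,j) with i<j is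
  omega_ij = omega_ji.  All generators have total degree 1, so the free
  graded-commutative algebra on them is the exterior algebra on them.
  Elements of this exterior algebra are coefficient functions on finite sets of
  generators (the monomial e_S is the product of the elements of S in
  increasing lexicographic order).\<close>

type_synonym gen = "nat \<times> nat \<times> nat"
type_synonym ext = "gen set \<Rightarrow> rat"

definition qscale :: "rat \<Rightarrow> ('a \<Rightarrow> rat) \<Rightarrow> ('a \<Rightarrow> rat)" where
  "qscale c f = (\<lambda>x. c * f x)"

abbreviation qspan :: "('a \<Rightarrow> rat) set \<Rightarrow> ('a \<Rightarrow> rat) set" where
  "qspan \<equiv> module.span qscale"

abbreviation qdim :: "('a \<Rightarrow> rat) set \<Rightarrow> nat" where
  "qdim \<equiv> vector_space.dim qscale"

definition gens :: "nat \<Rightarrow> gen set" where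
  "gens n = {(0,i,0) | i. i < n} \<union> {(1,i,0) | i. i < n} \<union> {(2,i,j) | i j. i < j \<and> j < n}"

definition mono :: "gen set \<Rightarrow> ext" where
  "mono S = (\<lambda>U. if U = S then 1 else 0)"

definition one :: ext where "one = mono {}"

definition genel :: "gen \<Rightarrow> ext" where "genel g = mono {g}"

definition ksign :: "gen set \<Rightarrow> gen set \<Rightarrow> rat" where
  "ksign S T = (-1) ^ card {(s,t). s \<in> S \<and> t \<in> T \<and> t < s}"

definition wedge :: "ext \<Rightarrow> ext \<Rightarrow> ext" where
  "wedge a b = (\<lambda>U. \<Sum>S\<in>Pow U. a S * b (U - S) * ksign S (U - S))"

definition xg :: "nat \<Rightarrow> ext" where "xg i = genel (0,i,0)"
definition yg :: "nat \<Rightarrow> ext" where "yg i = genel (1,i,0)"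
definition om :: "nat \<Rightarrow> nat \<Rightarrow> ext" where "om i j = genel (2, min i j, max i j)"

definition pdeg :: "gen set \<Rightarrow> nat" where "pdeg S = card {g \<in> S. fst g \<le> 1}"
definition qdeg :: "gen set \<Rightarrow> nat" where "qdeg S = card {g \<in> S. fst g = 2}"

definition homog :: "nat \<Rightarrow> nat \<Rightarrow> ext \<Rightarrow> bool" where
  "homog p q a \<longleftrightarrow> (\<forall>S. a S \<noteq> 0 \<longrightarrow> pdeg S = p \<and> qdeg S = q)"

definition rels :: "nat \<Rightarrow> ext set" where
  "rels n =
     {wedge (xg i - xg j) (om i j) | i j. i < n \<and> j < n \<and> i \<noteq> j}
   \<union> {wedge (yg i - yg j) (om i j) | i j. i < n \<and> j < n \<and> i \<noteq> j}
   \<union> {wedge (om i j) (om j k) + wedge (om j k) (om k i) + wedge (om k i) (om i j) | i j k.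
        i < n \<and> j < n \<and> k < n \<and> i \<noteq> j \<and> j \<noteq> k \<and> i \<noteq> k}"

definition Iid :: "nat \<Rightarrow> ext set" where
  "Iid n = qspan {wedge (wedge (mono S) r) (mono T) | S T r.
                    S \<subseteq> gens n \<and> T \<subseteq> gens n \<and> r \<in> rels n}"

text \<open>The sub-algebra generated by x_i - x_j, y_i - y_j, omega_ij (lifted to the
  exterior algebra); its image in E_2(n) is E_2(n,E).\<close>
definition gensE :: "nat \<Rightarrow> ext set" where
  "gensE n = {xg i - xg j | i j. i < n \<and> j < n \<and> i \<noteq> j}
           \<union> {yg i - yg j | i j. i < n \<and> j < n \<and> i \<noteq> j}
           \<union> {om i j | i j. i < n \<and> j < n \<and> i \<noteq> j}"

inductive_set prodsE :: "nat \<Rightarrow> ext set" for n where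
  one: "one \<in> prodsE n"
| step: "a \<in> prodsE n \<Longrightarrow> g \<in> gensE n \<Longrightarrow> wedge g a \<in> prodsE n"

definition Atil :: "nat \<Rightarrow> ext set" where "Atil n = qspan (prodsE n)"

text \<open>The differential d_2: the derivation (for total degree) with d x_i = d y_i = 0
  and d omega_ij = (x_i - x_j)(y_i - y_j), on the exterior algebra.\<close>
definition domega :: "gen \<Rightarrow> ext" where
  "domega g = (case g of (t,i,j) \<Rightarrow> wedge (xg i - xg j) (yg i - yg j))"

definition Dmono :: "gen set \<Rightarrow> ext" where
  "Dmono S = (\<Sum>g\<in>{g \<in> S. fst g = 2}.
      qscale ((-1) ^ card {h \<in> S. h < g})
        (wedge (wedge (mono {h \<in> S. h < g}) (domega g)) (mono {h \<in> S. g < h})))"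

definition D :: "nat \<Rightarrow> ext \<Rightarrow> ext" where
  "D n a = (\<Sum>S\<in>Pow (gens n). qscale (a S) (Dmono S))"

text \<open>E_3^{p,q}(n,E) = Z/B, with Z the cycles and B the boundaries plus the
  relations, computed in the lift.\<close>
definition Zc :: "nat \<Rightarrow> nat \<Rightarrow> nat \<Rightarrow> ext set" where
  "Zc n p q = {a \<in> Atil n. homog p q a \<and> D n a \<in> Iid n}"

definition Bd :: "nat \<Rightarrow> nat \<Rightarrow> nat \<Rightarrow> ext set" where
  "Bd n p q = {b + D n c | b c. b \<in> Atil n \<inter> Iid n \<and> homog p q b \<and>
                 (if 2 \<le> p then c \<in> Atil n \<and> homog (p - 2) (q + 1) c else c = 0)}"

definition E3dim :: "nat \<Rightarrow> nat \<Rightarrow> nat \<Rightarrow> nat" where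
  "E3dim n p q = qdim (Zc n p q) - qdim (Bd n p q)"

definition alg_map :: "nat \<Rightarrow> (gen \<Rightarrow> ext) \<Rightarrow> ext \<Rightarrow> ext" where
  "alg_map n f a = (\<Sum>S\<in>Pow (gens n).
      qscale (a S) (foldr wedge (map f (sorted_list_of_set S)) one))"

definition pgen :: "(nat \<Rightarrow> nat) \<Rightarrow> gen \<Rightarrow> gen" where
  "pgen \<sigma> g = (case g of (t,i,j) \<Rightarrow>
      if t = 2 then (2, min (\<sigma> i) (\<sigma> j), max (\<sigma> i) (\<sigma> j)) else (t, \<sigma> i, 0))"

definition permact :: "nat \<Rightarrow> (nat \<Rightarrow> nat) \<Rightarrow> ext \<Rightarrow> ext" where
  "permact n \<sigma> = alg_map n (\<lambda>g. genel (pgen \<sigma> g))"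

type_synonym mat2 = "rat \<times> rat \<times> rat \<times> rat"  (* (a,b,c,d) = [[a,b],[c,d]] *)

definition SL2 :: "mat2 set" where
  "SL2 = {(a,b,c,d). a * d - b * c = 1}"

definition slact :: "nat \<Rightarrow> mat2 \<Rightarrow> ext \<Rightarrow> ext" where
  "slact n m = (case m of (a,b,c,d) \<Rightarrow> alg_map n (\<lambda>g. case g of (t,i,j) \<Rightarrow>
      if t = 0 then qscale a (xg i) + qscale c (yg i)
      else if t = 1 then qscale b (xg i) + qscale d (yg i)
      else genel g))"

definition act :: "nat \<Rightarrow> (nat \<Rightarrow> nat) \<times> mat2 \<Rightarrow> ext \<Rightarrow> ext" where
  "act n sg a = permact n (fst sg) (slact n (snd sg) a)"

text \<open>Target representation.  V(1) = sum-zero vectors in Q^n (spanned by the x_i),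
  Lambda^p V(1) inside the exterior algebra on the x_i.\<close>
definition V1 :: "nat \<Rightarrow> ext set" where
  "V1 n = {(\<Sum>i<n. qscale (c i) (xg i)) | c. (\<Sum>i<n. c i) = 0}"

definition LamV1 :: "nat \<Rightarrow> nat \<Rightarrow> ext set" where
  "LamV1 n p = qspan {foldr wedge vs one | vs. length vs = p \<and> set vs \<subseteq> V1 n}"

text \<open>V_p = Sym^p Q^2: f k = coefficient of u^k v^(p-k); SL_2 acts by
  (g.f)(u,v) = f(a u + c v, b u + d v).\<close>
definition Vp :: "nat \<Rightarrow> (nat \<Rightarrow> rat) set" where
  "Vp p = {f. \<forall>k. p < k \<longrightarrow> f k = 0}"

definition slVp :: "nat \<Rightarrow> mat2 \<Rightarrow> (nat \<Rightarrow> rat) \<Rightarrow> (nat \<Rightarrow> rat)" where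
  "slVp p m f = (case m of (a,b,c,d) \<Rightarrow> (\<lambda>mm. if mm \<le> p then
      (\<Sum>k\<le>p. f k * (\<Sum>i\<le>k. if i \<le> mm \<and> mm - i \<le> p - k then
          of_nat (k choose i) * a ^ i * c ^ (k - i) *
          of_nat ((p - k) choose (mm - i)) * b ^ (mm - i) * d ^ (p - k - (mm - i))
        else 0))
      else 0))"

definition delta :: "nat \<Rightarrow> nat \<Rightarrow> rat" where "delta k = (\<lambda>m. if m = k then 1 else 0)"

definition Tens :: "nat \<Rightarrow> nat \<Rightarrow> (gen set \<times> nat \<Rightarrow> rat) set" where
  "Tens n p = qspan {(\<lambda>(S,k). w S * f k) | w f. w \<in> LamV1 n p \<and> f \<in> Vp p}"

definition tact :: "nat \<Rightarrow> nat \<Rightarrow> (nat \<Rightarrow> nat) \<times> mat2 \<Rightarrow>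
                    (gen set \<times> nat \<Rightarrow> rat) \<Rightarrow> (gen set \<times> nat \<Rightarrow> rat)" where
  "tact n p sg F = (\<lambda>(U,m). \<Sum>S\<in>Pow (gens n). \<Sum>k\<le>p.
      F (S,k) * permact n (fst sg) (mono S) U * slVp p (snd sg) (delta k) m)"

end

theory Submission
  imports Defs "HOL-Computational_Algebra.Polynomial"
begin

text \<open>Let V be the space spanned by the differences x_i - x_j.  In row 0 all relations vanish and
  everything is a cycle, so the cycles form the exterior power of V \<otimes> Q^2, and the boundaries form
  the degree p part of the ideal generated by the products (x_i - x_j)(y_i - y_j).  Substituting
  s x_i for x_i and t x_i for y_i kills this ideal and turns a cycle into a homogeneous polynomial
  of degree p in s, t with coefficients in the exterior power of V; its coefficients are the
  components of the isomorphism.  Equivariance only has to be checked on generators, because the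
  actions and the substitution are algebra maps.  For injectivity, polarising the relations gives
  X_i Y_j = - X_j Y_i for the basis X_i = x_i - x_N, Y_i = y_i - y_N (with n = N + 1), so that modulo
  boundaries every monomial is a multiple of one with increasing indices and with all X factors in
  front; the images of these monomials are linearly independent.\<close>

text \<open>By skew Cauchy duality the degree p exterior power of V \<otimes> Q^2 is the sum of the
  S_\<lambda>(V) \<otimes> S_\<lambda>'(Q^2), \<lambda>' being the conjugate of \<lambda>. In degree
  2 the summands are Lambda^2(V) \<otimes> Sym^2(Q^2) and Sym^2(V) \<otimes> Lambda^2(Q^2), and the
  d omega_ij span the second one, in agreement with the count n(n-1)/2 = dim Sym^2(V). The ideal
  generated by it removes everything except Lambda^p(V) \<otimes> Sym^p(Q^2); the proof makes this
  explicit without decomposing representations. The substitution contracts Q^2 with the functional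
  (s,t), so that Sym^p(Q^2) appears as forms of degree p in s and t. Coefficients being rational, s
  and t are numbers rather than variables, and components are recovered because Q is infinite.
  Singling out the index N serves twice: the pair (i,N) yields X_i Y_i itself, from which
  polarisation starts, and on sets avoiding x_N a product of X_i has the same coefficients as the
  product of the x_i, which makes linear independence visible.\<close>

section \<open>Linear algebra of rational-valued functions\<close>

interpretation qs: vector_space "qscale :: rat \<Rightarrow> ('a \<Rightarrow> rat) \<Rightarrow> ('a \<Rightarrow> rat)"
  by unfold_locales (auto simp: qscale_def fun_eq_iff algebra_simps)

lemma qscale_apply [simp]: "qscale c f x = c * f x"
  by (simp add: qscale_def)

lemma sum_apply: "(\<Sum>i\<in>A. f i) x = (\<Sum>i\<in>A. f i x :: rat)"
  by (induction A rule: infinite_finite_induct) auto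

lemma span_image_subset:
  fixes f :: "('a \<Rightarrow> rat) \<Rightarrow> ('b \<Rightarrow> rat)"
  assumes "\<And>a b. f (a + b) = f a + f b" "\<And>c a. f (qscale c a) = qscale c (f a)"
    and "f ` X \<subseteq> W" "qs.subspace W"
  shows "f ` qspan X \<subseteq> W"
proof -
  have f0: "f 0 = 0" using assms(2)[of 0 0] by simp
  have "f x \<in> W" if "x \<in> qspan X" for x
    using that
  proof (induction rule: qs.span_induct_alt)
    case base show ?case unfolding f0 by (rule qs.subspace_0[OF assms(4)])
  next
    case (step c x y)
    then have "qscale c (f x) + f y \<in> W"
      using assms(3,4) by (blast intro: qs.subspace_add qs.subspace_scale)
    then show ?case unfolding assms(1,2) .
  qed
  then show ?thesis by auto
qed

subsection \<open>The exterior algebra\<close>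

text \<open>\<open>Pow U\<close> is infinite, and a sum over an infinite set is 0 by convention. A
  product thus vanishes on infinite sets even when its factors do not, which is why the unit laws
  below carry a hypothesis.\<close>

lemma wedge_infinite: "infinite U \<Longrightarrow> wedge a b U = 0"
  by (simp add: wedge_def finite_Pow_iff)

lemma wedge_add_left: "wedge (a + b) c = wedge a c + wedge b c"
  by (rule ext) (simp add: wedge_def algebra_simps sum.distrib)
lemma wedge_add_right: "wedge c (a + b) = wedge c a + wedge c b"
  by (rule ext) (simp add: wedge_def algebra_simps sum.distrib)
lemma wedge_scale_left: "wedge (qscale r a) b = qscale r (wedge a b)"
  by (rule ext) (simp add: wedge_def algebra_simps sum_distrib_left)
lemma wedge_scale_right: "wedge a (qscale r b) = qscale r (wedge a b)"
  by (rule ext) (simp add: wedge_def algebra_simps sum_distrib_left)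
lemma wedge_zero_left [simp]: "wedge 0 b = 0"
  by (rule ext) (simp add: wedge_def)
lemma wedge_zero_right [simp]: "wedge a 0 = 0"
  by (rule ext) (simp add: wedge_def)
lemma wedge_minus_left: "wedge (- a) b = - wedge a b"
  by (rule ext) (simp add: wedge_def sum_negf)
lemma wedge_minus_right: "wedge a (- b) = - wedge a b"
  by (rule ext) (simp add: wedge_def sum_negf)
lemma wedge_diff_left: "wedge (a - b) c = wedge a c - wedge b c"
  by (rule ext) (simp add: wedge_def algebra_simps sum_subtractf)
lemma wedge_diff_right: "wedge c (a - b) = wedge c a - wedge c b"
  by (rule ext) (simp add: wedge_def algebra_simps sum_subtractf)
lemma wedge_sum_left: "wedge (\<Sum>i\<in>A. f i) b = (\<Sum>i\<in>A. wedge (f i) b)"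
proof (induction A rule: infinite_finite_induct)
  case (insert x F)
  then show ?case by (simp only: sum.insert[OF insert(1,2)] wedge_add_left)
qed (simp_all only: sum.infinite sum.empty wedge_zero_left not_False_eq_True)
text \<open>\<open>ksign\<close> counts inversions, and the inversions against a disjoint union
  split into those of its two parts. Finiteness enters because an infinite set has
  \<open>card\<close> 0.\<close>

lemma ksign_Un_left:
  assumes "finite S" "finite T" "finite V" "S \<inter> T = {}"
  shows "ksign (S \<union> T) V = ksign S V * ksign T V"
proof -
  have "{(s,t). s \<in> S \<union> T \<and> t \<in> V \<and> t < s} =
     {(s,t). s \<in> S \<and> t \<in> V \<and> t < s} \<union> {(s,t). s \<in> T \<and> t \<in> V \<and> t < s}" by auto
  moreover have "finite {(s,t). s \<in> S \<and> t \<in> V \<and> t < s}"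
    by (rule finite_subset[of _ "S \<times> V"]) (use assms in auto)
  moreover have "finite {(s,t). s \<in> T \<and> t \<in> V \<and> t < s}"
    by (rule finite_subset[of _ "T \<times> V"]) (use assms in auto)
  ultimately show ?thesis using assms(4)
    by (subst power_add[symmetric] ksign_def)+
       (auto simp: ksign_def power_add[symmetric] intro!: arg_cong[where f="\<lambda>k. (-1)^k"] card_Un_disjoint)
qed

lemma ksign_Un_right:
  assumes "finite S" "finite T" "finite V" "T \<inter> V = {}"
  shows "ksign S (T \<union> V) = ksign S T * ksign S V"
proof -
  have "{(s,t). s \<in> S \<and> t \<in> T \<union> V \<and> t < s} =
     {(s,t). s \<in> S \<and> t \<in> T \<and> t < s} \<union> {(s,t). s \<in> S \<and> t \<in> V \<and> t < s}" by auto
  moreover have "finite {(s,t). s \<in> S \<and> t \<in> T \<and> t < s}"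
    by (rule finite_subset[of _ "S \<times> T"]) (use assms in auto)
  moreover have "finite {(s,t). s \<in> S \<and> t \<in> V \<and> t < s}"
    by (rule finite_subset[of _ "S \<times> V"]) (use assms in auto)
  ultimately show ?thesis using assms(4)
    by (auto simp: ksign_def power_add[symmetric] intro!: arg_cong[where f="\<lambda>k. (-1)^k"] card_Un_disjoint)
qed

text \<open>Both sides sum over the ordered decompositions of U into three blocks S, T, V, where R =
  S \<union> T on the left. The two signs agree: each counts the inversions between S and T, S and
  V, T and V.\<close>

lemma wedge_assoc: "wedge (wedge a b) c = wedge a (wedge b c)"
proof
  fix U
  show "wedge (wedge a b) c U = wedge a (wedge b c) U"
  proof (cases "finite U")
    case False then show ?thesis by (simp add: wedge_infinite)
  next
    case fin: True
    have fs: "finite X" if "X \<subseteq> U" for X using that fin finite_subset by blast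
    have "wedge (wedge a b) c U =
      (\<Sum>R\<in>Pow U. \<Sum>S\<in>Pow R. a S * b (R - S) * c (U - R) * (ksign S (R - S) * ksign R (U - R)))"
      by (simp add: wedge_def sum_distrib_left sum_distrib_right algebra_simps)
    also have "\<dots> = (\<Sum>(R,S)\<in>Sigma (Pow U) Pow. a S * b (R - S) * c (U - R) * (ksign S (R - S) * ksign R (U - R)))"
      by (subst sum.Sigma) (auto simp: fin intro: fs)
    also have "\<dots> = (\<Sum>(S,T)\<in>Sigma (Pow U) (\<lambda>S. Pow (U - S)).
        a S * b T * c (U - S - T) * (ksign T (U - S - T) * ksign S (U - S)))"
    proof (rule sum.reindex_bij_witness[where i = "\<lambda>(S,T). (S \<union> T, S)" and j = "\<lambda>(R,S). (S, R - S)"], goal_cases)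
      case (5 x)
      obtain R S where x: "x = (R,S)" and RS: "R \<subseteq> U" "S \<subseteq> R" using 5 by auto
      define T V where "T = R - S" and "V = U - R"
      have e: "R = S \<union> T" "U - S = T \<union> V" "U - S - T = V" "S \<inter> T = {}" "T \<inter> V = {}"
        "finite S" "finite T" "finite V"
        using RS fs by (auto simp: T_def V_def)
      have "ksign S T * ksign (S \<union> T) V = ksign T V * ksign S (T \<union> V)"
        using e by (simp add: ksign_Un_left ksign_Un_right)
      then show ?case unfolding x using e T_def[symmetric] V_def[symmetric] by (simp del: Diff_eq_empty_iff)
    qed auto
    also have "\<dots> = wedge a (wedge b c) U"
      by (subst sum.Sigma[symmetric])
         (auto simp: fin wedge_def sum_distrib_left sum_distrib_right algebra_simps intro: fs)
    finally show ?thesis .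
  qed
qed

lemma ksign_empty [simp]: "ksign {} T = 1" "ksign S {} = 1"
  by (simp_all add: ksign_def)

lemma wedge_one_right:
  assumes "\<And>U. infinite U \<Longrightarrow> a U = 0"
  shows "wedge a one = a"
proof
  fix U show "wedge a one U = a U"
  proof (cases "finite U")
    case True
    have "wedge a one U = (\<Sum>S\<in>Pow U. if S = U then a U else 0)"
      unfolding wedge_def one_def mono_def by (rule sum.cong) auto
    then show ?thesis using True by simp
  qed (use assms wedge_infinite in auto)
qed

lemma wedge_one_left:
  assumes "\<And>U. infinite U \<Longrightarrow> a U = 0"
  shows "wedge one a = a"
proof
  fix U show "wedge one a U = a U"
  proof (cases "finite U")
    case True
    have "wedge one a U = (\<Sum>S\<in>Pow U. if S = {} then a U else 0)"
      unfolding wedge_def one_def mono_def by (rule sum.cong) auto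
    then show ?thesis using True by simp
  qed (use assms wedge_infinite in auto)
qed

lemma wedge_mono:
  assumes "finite S" "finite T"
  shows "wedge (mono S) (mono T) = (if S \<inter> T = {} then qscale (ksign S T) (mono (S \<union> T)) else 0)"
proof
  fix U show "wedge (mono S) (mono T) U = (if S \<inter> T = {} then qscale (ksign S T) (mono (S \<union> T)) else 0) U"
  proof (cases "finite U")
    case True
    have "wedge (mono S) (mono T) U = (\<Sum>R\<in>Pow U. if R = S then (if U - S = T then ksign S T else 0) else 0)"
      unfolding wedge_def mono_def by (rule sum.cong) auto
    also have "\<dots> = (if S \<subseteq> U \<and> U - S = T then ksign S T else 0)" using True by auto
    also have "\<dots> = (if S \<inter> T = {} then qscale (ksign S T) (mono (S \<union> T)) else 0) U"
      by (auto simp: mono_def)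
    finally show ?thesis .
  next
    case False then show ?thesis using assms by (auto simp: wedge_infinite mono_def)
  qed
qed

section \<open>Elements of total degree one\<close>

text \<open>Total degree, so the omega generators are included. Since infinite sets have
  \<open>card\<close> 0, such an element also vanishes on infinite sets.\<close>

definition deg1 :: "ext \<Rightarrow> bool" where
  "deg1 a \<longleftrightarrow> (\<forall>S. a S \<noteq> 0 \<longrightarrow> card S = 1)"

lemma deg1_genel [simp]: "deg1 (genel g)"
  by (simp add: deg1_def genel_def mono_def)
lemma deg1_diff: "deg1 a \<Longrightarrow> deg1 b \<Longrightarrow> deg1 (a - b)"
  by (auto simp: deg1_def) (metis diff_0_right)
lemma deg1_scale: "deg1 a \<Longrightarrow> deg1 (qscale c a)"
  by (auto simp: deg1_def)
lemma deg1_zero [simp]: "deg1 0" by (simp add: deg1_def)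

lemma ksign_singletons: "ksign {g} {h} = (if h < g then -1 else 1)"
proof -
  have "{(s,t). s \<in> {g} \<and> t \<in> {h} \<and> t < s} = (if h < g then {(g,h)} else {})" by auto
  then show ?thesis by (simp add: ksign_def)
qed

text \<open>Passing from S to U - S exchanges the factors. Where both coefficients are nonzero, U
  consists of two distinct generators, and exactly one of their two orders is an inversion.\<close>

lemma wedge_anticommute:
  assumes "deg1 a" "deg1 b"
  shows "wedge a b = - wedge b a"
proof
  fix U
  show "wedge a b U = (- wedge b a) U"
  proof (cases "finite U")
    case True
    have "wedge a b U = (\<Sum>S\<in>Pow U. a (U - S) * b S * ksign (U - S) S)"
      unfolding wedge_def
      by (rule sum.reindex_bij_witness[where i = "\<lambda>S. U - S" and j = "\<lambda>S. U - S"])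
         (auto simp: double_diff)
    also have "\<dots> = (\<Sum>S\<in>Pow U. - (b S * a (U - S) * ksign S (U - S)))"
    proof (rule sum.cong, goal_cases)
      case (2 S)
      show ?case
      proof (cases "b S = 0 \<or> a (U - S) = 0")
        case False
        then obtain g h where S: "S = {h}" "U - S = {g}" using assms
          by (metis card_1_singletonE deg1_def)
        then have "g \<noteq> h" by auto
        then have "ksign {g} {h} = - ksign {h} {g}"
        proof (cases "g < h")
          case True
          then have "\<not> h < g" by (rule less_not_sym)
          then show ?thesis using True by (simp only: ksign_singletons if_True if_False)
        next
          case False
          then have "h < g" using \<open>g \<noteq> h\<close> linorder_less_linear by blast
          then show ?thesis using False by (simp only: ksign_singletons if_True if_False minus_minus)
        qed
        then show ?thesis unfolding S(2) unfolding S(1) by simp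
      qed auto
    qed auto
    also have "\<dots> = (- wedge b a) U" by (simp add: wedge_def sum_negf)
    finally show ?thesis .
  qed (simp add: wedge_infinite)
qed

lemma ext_double_zero: "(a::ext) = - a \<Longrightarrow> a = 0"
  by (auto simp: fun_eq_iff)

lemma wedge_self: "deg1 a \<Longrightarrow> wedge a a = 0"
  using wedge_anticommute ext_double_zero by blast

lemma wedge_left_anticommute:
  assumes "deg1 a" "deg1 b"
  shows "wedge a (wedge b c) = - wedge b (wedge a c)"
  by (metis assms wedge_anticommute wedge_assoc wedge_minus_left)

lemma wedge_left_self: "deg1 a \<Longrightarrow> wedge a (wedge a c) = 0"
  by (metis wedge_assoc wedge_self wedge_zero_left)

abbreviation wprod :: "ext list \<Rightarrow> ext" where
  "wprod vs \<equiv> foldr wedge vs one"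

lemma wprod_infinite: "infinite U \<Longrightarrow> wprod vs U = 0"
  by (cases vs) (auto simp: wedge_infinite one_def mono_def)

text \<open>Putting a generator in front of larger ones creates no inversion, so the sorted product
  carries no sign.\<close>

lemma mono_eq_wprod:
  assumes "finite S"
  shows "mono S = wprod (map genel (sorted_list_of_set S))"
proof -
  have "mono (set l) = wprod (map genel l)" if "sorted l" "distinct l" for l
    using that
  proof (induction l)
    case Nil then show ?case by (simp add: one_def)
  next
    case (Cons g l)
    have "{(s,t). s \<in> {g} \<and> t \<in> set l \<and> t < s} = {}" using Cons.prems by (auto simp del: less_prod_simp simp: not_less)
    then have "ksign {g} (set l) = 1" by (simp only: ksign_def card.empty power_0)
    then have "wedge (genel g) (mono (set l)) = mono (set (g # l))"
      using Cons.prems by (auto simp: genel_def wedge_mono)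
    then show ?case using Cons by simp
  qed
  from this[of "sorted_list_of_set S"] assms show ?thesis by simp
qed

lemma finite_gens [simp]: "finite (gens n)"
proof -
  have "gens n \<subseteq> {0,1,2} \<times> {..n} \<times> {..n}" by (auto simp: gens_def)
  then show ?thesis by (rule finite_subset) auto
qed

section \<open>Linear maps and elements supported on the generators\<close>

definition qlin :: "(('a \<Rightarrow> rat) \<Rightarrow> ('b \<Rightarrow> rat)) \<Rightarrow> bool" where
  "qlin f \<longleftrightarrow> (\<forall>a b. f (a + b) = f a + f b) \<and> (\<forall>c a. f (qscale c a) = qscale c (f a))"

lemma qlinI: "(\<And>a b. f (a + b) = f a + f b) \<Longrightarrow> (\<And>c a. f (qscale c a) = qscale c (f a)) \<Longrightarrow> qlin f"
  by (simp add: qlin_def)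
lemma qlin_add: "qlin f \<Longrightarrow> f (a + b) = f a + f b"
  by (simp add: qlin_def)
lemma qlin_scale: "qlin f \<Longrightarrow> f (qscale c a) = qscale c (f a)"
  by (simp add: qlin_def)
lemma qlin_zero: "qlin f \<Longrightarrow> f 0 = 0"
  using qlin_scale[of f 0 0] by simp
lemma qlin_minus: "qlin f \<Longrightarrow> f (- a) = - f a"
  using qlin_scale[of f "-1" a] by simp
lemma qlin_diff: "qlin f \<Longrightarrow> f (a - b) = f a - f b"
  using qlin_add[of f a "- b"] qlin_minus[of f b] by simp
lemma qlin_sum:
  assumes "qlin f" shows "f (\<Sum>i\<in>A. g i) = (\<Sum>i\<in>A. f (g i))"
proof (induction A rule: infinite_finite_induct)
  case (insert x F)
  then show ?case by (simp only: sum.insert[OF insert(1,2)] qlin_add[OF assms])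
qed (simp_all only: sum.infinite sum.empty qlin_zero[OF assms] not_False_eq_True)

lemma qlin_compose: "qlin f \<Longrightarrow> qlin g \<Longrightarrow> qlin (\<lambda>a. f (g a))"
  by (simp add: qlin_def)

lemma qlin_span:
  assumes "qlin f" "\<And>x. x \<in> X \<Longrightarrow> f x \<in> W" "qs.subspace W" "a \<in> qspan X"
  shows "f a \<in> W"
  using span_image_subset[of f X W] assms by (auto simp: qlin_def)

lemma qlin_wedge_left: "qlin (\<lambda>a. wedge a b)"
  by (rule qlinI) (simp_all only: wedge_add_left wedge_scale_left)
lemma qlin_wedge_right: "qlin (\<lambda>b. wedge a b)"
  by (rule qlinI) (simp_all only: wedge_add_right wedge_scale_right)

text \<open>The type \<open>ext\<close> also contains functions living on triples outside
  \<open>gens n\<close> or on infinite sets. \<open>alg_map\<close> and \<open>D\<close> ignore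
  those coefficients, so multiplicativity can be claimed only for elements supported in
  \<open>gens n\<close>.\<close>

definition supp :: "nat \<Rightarrow> ext \<Rightarrow> bool" where
  "supp n a \<longleftrightarrow> (\<forall>S. a S \<noteq> 0 \<longrightarrow> S \<subseteq> gens n)"

lemma supp_infinite: "supp n a \<Longrightarrow> infinite U \<Longrightarrow> a U = 0"
  using finite_subset[OF _ finite_gens] unfolding supp_def by blast
lemma supp_zero: "supp n 0" by (simp add: supp_def)
lemma supp_add: "supp n a \<Longrightarrow> supp n b \<Longrightarrow> supp n (a + b)"
  by (auto simp: supp_def) (metis (no_types, lifting) add.right_neutral in_mono)
lemma supp_scale: "supp n a \<Longrightarrow> supp n (qscale c a)"
  by (auto simp: supp_def)
lemma subspace_supp: "qs.subspace {a. supp n a}"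
  by (rule qs.subspaceI) (auto intro: supp_add supp_scale simp: supp_zero)
lemma supp_diff: "supp n a \<Longrightarrow> supp n b \<Longrightarrow> supp n (a - b)"
  using qs.subspace_diff[OF subspace_supp] by auto
lemma supp_sum: "(\<And>i. i \<in> A \<Longrightarrow> supp n (f i)) \<Longrightarrow> supp n (\<Sum>i\<in>A. f i)"
  using qs.subspace_sum[OF subspace_supp, of A f] by auto
lemma supp_mono: "S \<subseteq> gens n \<Longrightarrow> supp n (mono S)"
  by (auto simp: supp_def mono_def split: if_splits)
lemma supp_genel: "g \<in> gens n \<Longrightarrow> supp n (genel g)"
  by (simp add: genel_def supp_mono)
lemma supp_one: "supp n one"
  by (simp add: one_def supp_mono)

lemma wedge_nonzeroE:
  assumes "wedge a b U \<noteq> 0"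
  obtains S where "finite U" "S \<subseteq> U" "a S \<noteq> 0" "b (U - S) \<noteq> 0"
proof -
  have "finite U" using assms wedge_infinite by blast
  moreover have "\<exists>S\<in>Pow U. a S * b (U - S) * ksign S (U - S) \<noteq> 0"
    using assms unfolding wedge_def by (rule contrapos_np) (auto intro: sum.neutral)
  ultimately show ?thesis using that by auto
qed

lemma supp_wedge:
  assumes "supp n a" "supp n b" shows "supp n (wedge a b)"
  unfolding supp_def
proof (intro allI impI)
  fix U assume "wedge a b U \<noteq> 0"
  then obtain S where "S \<subseteq> U" "a S \<noteq> 0" "b (U - S) \<noteq> 0" by (rule wedge_nonzeroE)
  then have "S \<subseteq> gens n" "U - S \<subseteq> gens n" using assms by (auto simp: supp_def)
  then show "U \<subseteq> gens n" by blast
qed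

lemma supp_wprod: "(\<And>a. a \<in> set l \<Longrightarrow> supp n a) \<Longrightarrow> supp n (wprod l)"
  by (induction l) (auto intro: supp_wedge supp_one)

lemma supp_expand:
  assumes "supp n a" shows "a = (\<Sum>S\<in>Pow (gens n). qscale (a S) (mono S))"
proof
  fix U
  have "(\<Sum>S\<in>Pow (gens n). a S * mono S U) = (\<Sum>S\<in>Pow (gens n). if S = U then a U else 0)"
    by (rule sum.cong) (auto simp: mono_def)
  also have "\<dots> = a U" using assms by (auto simp: supp_def)
  finally show "a U = (\<Sum>S\<in>Pow (gens n). qscale (a S) (mono S)) U"
    by (simp add: sum_apply)
qed

text \<open>Agreement is required only on monomials that occur in \<open>a\<close>. A bidegree
  hypothesis on \<open>a\<close> thereby passes to each monomial, as \<open>D_om_wedge\<close>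
  needs.\<close>

lemma qlin_eq_on_supp:
  assumes "qlin F" "qlin G" "\<And>S. S \<subseteq> gens n \<Longrightarrow> a S \<noteq> 0 \<Longrightarrow> F (mono S) = G (mono S)" "supp n a"
  shows "F a = G a"
proof -
  have "F a = (\<Sum>S\<in>Pow (gens n). qscale (a S) (F (mono S)))"
    by (subst supp_expand[OF assms(4)]) (simp only: qlin_sum[OF assms(1)] qlin_scale[OF assms(1)])
  also have "\<dots> = (\<Sum>S\<in>Pow (gens n). qscale (a S) (G (mono S)))"
  proof (rule sum.cong[OF refl])
    fix S assume "S \<in> Pow (gens n)"
    then show "qscale (a S) (F (mono S)) = qscale (a S) (G (mono S))"
      using assms(3)[of S] by (cases "a S = 0") auto
  qed
  also have "\<dots> = G a"
    by (subst (2) supp_expand[OF assms(4)]) (simp only: qlin_sum[OF assms(2)] qlin_scale[OF assms(2)])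
  finally show ?thesis .
qed

subsection \<open>Algebra maps determined by their values on generators\<close>

lemma qlin_alg_map: "qlin (alg_map n f)"
proof (rule qlinI)
  show "alg_map n f (a + b) = alg_map n f a + alg_map n f b" for a b
    unfolding alg_map_def by (simp add: qs.scale_left_distrib sum.distrib)
  show "alg_map n f (qscale c a) = qscale c (alg_map n f a)" for c a
    unfolding alg_map_def qs.scale_sum_right by simp
qed

lemma alg_map_mono:
  assumes "S \<subseteq> gens n"
  shows "alg_map n f (mono S) = wprod (map f (sorted_list_of_set S))"
proof -
  have "alg_map n f (mono S) =
    (\<Sum>T\<in>Pow (gens n). if T = S then wprod (map f (sorted_list_of_set S)) else 0)"
    unfolding alg_map_def by (rule sum.cong) (auto simp: mono_def)
  then show ?thesis using assms by simp
qed

lemma alg_map_one [simp]: "alg_map n f one = one"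
  by (simp add: one_def alg_map_mono)

lemma alg_map_cong:
  assumes "\<And>g. g \<in> gens n \<Longrightarrow> f g = h g"
  shows "alg_map n f a = alg_map n h a"
  unfolding alg_map_def
proof (rule sum.cong[OF refl])
  fix S assume "S \<in> Pow (gens n)"
  then have "map f (sorted_list_of_set S) = map h (sorted_list_of_set S)"
    using assms finite_subset[OF _ finite_gens, of S n] by auto
  then show "qscale (a S) (wprod (map f (sorted_list_of_set S))) =
    qscale (a S) (wprod (map h (sorted_list_of_set S)))" by (simp only:)
qed

lemma deg1_infinite: "deg1 a \<Longrightarrow> infinite U \<Longrightarrow> a U = 0"
  by (auto simp: deg1_def)

lemma alg_map_genel:
  "g \<in> gens n \<Longrightarrow> deg1 (f g) \<Longrightarrow> alg_map n f (genel g) = f g"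
  by (simp add: genel_def alg_map_mono wedge_one_right deg1_infinite)

lemma wedge_wprod_member:
  assumes "deg1 a" "\<And>x. x \<in> set l \<Longrightarrow> deg1 x" "a \<in> set l"
  shows "wedge a (wprod l) = 0"
  using assms
proof (induction l)
  case (Cons x l)
  show ?case
  proof (cases "x = a")
    case False
    then have "wedge a (wprod l) = 0" using Cons by auto
    moreover have "wedge a (wedge x (wprod l)) = - wedge x (wedge a (wprod l))"
      by (rule wedge_left_anticommute) (use Cons in auto)
    ultimately show ?thesis by simp
  qed (simp add: wedge_left_self Cons.prems)
qed simp

text \<open>Moving the new factor to its sorted place costs one sign for each smaller generator it
  passes. This is the inversion count in \<open>ksign\<close>, so the images are sorted with the
  same sign as the generators themselves.\<close>

lemma wedge_wprod_insort:
  assumes "sorted l" "\<And>g. g \<in> insert g0 (set l) \<Longrightarrow> deg1 (f g)" "distinct l" "g0 \<notin> set l"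
  shows "wedge (f g0) (wprod (map f l)) =
    qscale ((-1) ^ card {t \<in> set l. t < g0}) (wprod (map f (insort g0 l)))"
  using assms
proof (induction l)
  case (Cons x l)
  show ?case
  proof (cases "g0 \<le> x")
    case True
    then have "t \<ge> g0" if "t \<in> set (x # l)" for t
      using that Cons.prems(1) by (auto simp del: less_eq_prod_simp intro: order_trans)
    then have "card {t \<in> set (x # l). t < g0} = 0"
      by (subst card_0_eq) (auto simp del: less_prod_simp less_eq_prod_simp simp: not_less)
    then show ?thesis using True by (simp only: power_0 qs.scale_one insort_key.simps if_True list.map foldr.simps o_apply id_apply)
  next
    case False
    then have lt: "x < g0" by (simp only: not_le)
    have "{t \<in> set (x # l). t < g0} = insert x {t \<in> set l. t < g0}" using lt by (auto simp del: less_prod_simp less_eq_prod_simp)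
    then have c: "card {t \<in> set (x # l). t < g0} = Suc (card {t \<in> set l. t < g0})"
      using Cons.prems(3) by simp
    have "wedge (f g0) (wprod (map f (x # l))) = - wedge (f x) (wedge (f g0) (wprod (map f l)))"
      using wedge_left_anticommute[of "f g0" "f x"] Cons.prems by simp
    also have "wedge (f g0) (wprod (map f l)) =
      qscale ((-1) ^ card {t \<in> set l. t < g0}) (wprod (map f (insort g0 l)))"
      by (rule Cons.IH) (use Cons.prems in auto)
    finally show ?thesis using False unfolding c
      by (simp only: wedge_scale_right power_Suc mult_minus1 qs.scale_minus_left
          insort_key.simps if_False list.map foldr.simps o_apply)
  qed
qed simp

lemma ksign_singleton_left: "ksign {g} T = (-1) ^ card {t \<in> T. t < g}"
proof -
  have "{(s,t). s \<in> {g} \<and> t \<in> T \<and> t < s} = Pair g ` {t \<in> T. t < g}" by auto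
  moreover have "inj_on (Pair g) {t \<in> T. t < g}" by (rule inj_onI) (rule Pair_inject)
  ultimately show ?thesis by (simp only: ksign_def card_image)
qed

lemma alg_map_genel_wedge:
  assumes f: "\<And>g. g \<in> gens n \<Longrightarrow> deg1 (f g)" and g: "g \<in> gens n" and b: "supp n b"
  shows "alg_map n f (wedge (genel g) b) = wedge (f g) (alg_map n f b)"
proof (rule qlin_eq_on_supp[OF _ _ _ b])
  show "qlin (\<lambda>b. alg_map n f (wedge (genel g) b))" "qlin (\<lambda>b. wedge (f g) (alg_map n f b))"
    by (intro qlin_compose[OF qlin_alg_map qlin_wedge_right] qlin_compose[OF qlin_wedge_right qlin_alg_map])+
  fix T assume T: "T \<subseteq> gens n"
  then have fin: "finite T" using finite_subset[OF _ finite_gens] by blast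
  show "alg_map n f (wedge (genel g) (mono T)) = wedge (f g) (alg_map n f (mono T))"
  proof (cases "g \<in> T")
    case True
    then have "wedge (genel g) (mono T) = 0" using fin by (simp add: genel_def wedge_mono)
    moreover have "wedge (f g) (wprod (map f (sorted_list_of_set T))) = 0"
      by (rule wedge_wprod_member) (use True T fin f g in auto)
    ultimately show ?thesis using T by (simp add: alg_map_mono qlin_zero[OF qlin_alg_map])
  next
    case False
    have "wedge (f g) (wprod (map f (sorted_list_of_set T))) =
      qscale (ksign {g} T) (wprod (map f (insort g (sorted_list_of_set T))))"
      by (subst wedge_wprod_insort) (use False T fin f g in \<open>auto simp: ksign_singleton_left\<close>)
    moreover have "wedge (genel g) (mono T) = qscale (ksign {g} T) (mono (insert g T))"
      using False fin by (simp add: genel_def wedge_mono)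
    ultimately show ?thesis using T g False fin
      by (simp add: alg_map_mono qlin_scale[OF qlin_alg_map] sorted_list_of_set.sorted_key_list_of_set_insert_remove)
  qed
qed

text \<open>The universal property of the exterior algebra: images of total degree one anticommute
  and square to zero, so every assignment of such images to the generators extends
  multiplicatively.\<close>

lemma alg_map_wedge:
  assumes f: "\<And>g. g \<in> gens n \<Longrightarrow> deg1 (f g)" and a: "supp n a" and b: "supp n b"
  shows "alg_map n f (wedge a b) = wedge (alg_map n f a) (alg_map n f b)"
proof (rule qlin_eq_on_supp[OF _ _ _ a])
  show "qlin (\<lambda>a. alg_map n f (wedge a b))" "qlin (\<lambda>a. wedge (alg_map n f a) (alg_map n f b))"
    by (intro qlin_compose[OF qlin_alg_map qlin_wedge_left] qlin_compose[OF qlin_wedge_left qlin_alg_map])+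
  fix S assume S: "S \<subseteq> gens n"
  then have fin: "finite S" using finite_subset[OF _ finite_gens] by blast
  \<comment> \<open>Arbitrary lists of generators are allowed, so that peeling off the first one
    needs no ordering.\<close>
  have *: "alg_map n f (wedge (wprod (map genel gs)) b) = wedge (wprod (map f gs)) (alg_map n f b)"
    if "set gs \<subseteq> gens n" for gs
    using that
  proof (induction gs)
    case Nil
    have "alg_map n f b U = 0" if "infinite U" for U
      unfolding alg_map_def using that by (auto simp: sum_apply wprod_infinite)
    then show ?case using supp_infinite[OF b] by (simp add: wedge_one_left)
  next
    case (Cons g gs)
    have "supp n (wedge (wprod (map genel gs)) b)"
      by (intro supp_wedge supp_wprod b) (use Cons.prems in \<open>auto intro: supp_genel\<close>)
    then show ?case using Cons alg_map_genel_wedge[OF f] by (simp add: wedge_assoc)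
  qed
  show "alg_map n f (wedge (mono S) b) = wedge (alg_map n f (mono S)) (alg_map n f b)"
    using *[of "sorted_list_of_set S"] fin S by (simp add: mono_eq_wprod[symmetric] alg_map_mono)
qed

lemma alg_map_wprod:
  assumes "\<And>g. g \<in> gens n \<Longrightarrow> deg1 (f g)" "\<And>a. a \<in> set l \<Longrightarrow> supp n a"
  shows "alg_map n f (wprod l) = wprod (map (alg_map n f) l)"
  using assms(2)
proof (induction l)
  case (Cons a l)
  then show ?case using alg_map_wedge[of n f a "wprod l"] assms(1) supp_wprod[of l n] by simp
qed simp

text \<open>This reduces identities between composites, in particular equivariance, to a comparison
  on generators.\<close>

lemma alg_map_compose:
  assumes "\<And>g. g \<in> gens n \<Longrightarrow> deg1 (f g)" "\<And>g. g \<in> gens n \<Longrightarrow> supp n (h g)" "supp n a"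
  shows "alg_map n f (alg_map n h a) = alg_map n (\<lambda>g. alg_map n f (h g)) a"
proof (rule qlin_eq_on_supp[OF _ _ _ assms(3)])
  show "qlin (\<lambda>a. alg_map n f (alg_map n h a))" "qlin (\<lambda>a. alg_map n (\<lambda>g. alg_map n f (h g)) a)"
    by (intro qlin_compose[OF qlin_alg_map qlin_alg_map] qlin_alg_map)+
  fix S assume S: "S \<subseteq> gens n"
  then have fin: "finite S" using finite_subset[OF _ finite_gens] by blast
  have "alg_map n f (wprod (map h (sorted_list_of_set S))) =
    wprod (map (alg_map n f) (map h (sorted_list_of_set S)))"
    by (rule alg_map_wprod) (use assms S fin in auto)
  then show "alg_map n f (alg_map n h (mono S)) = alg_map n (\<lambda>g. alg_map n f (h g)) (mono S)"
    using S by (simp add: alg_map_mono o_def)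
qed

lemma supp_alg_map:
  assumes "\<And>g. g \<in> gens n \<Longrightarrow> supp n (h g)"
  shows "supp n (alg_map n h a)"
  unfolding alg_map_def
proof (intro supp_sum supp_scale supp_wprod)
  fix S b assume "S \<in> Pow (gens n)" "b \<in> set (map h (sorted_list_of_set S))"
  then show "supp n b" using assms finite_subset[of S "gens n"] by auto
qed

subsection \<open>Bidegrees\<close>

lemma homog_zero: "homog p q 0" by (simp add: homog_def)
lemma homog_add: "homog p q a \<Longrightarrow> homog p q b \<Longrightarrow> homog p q (a + b)"
  unfolding homog_def by (metis add.right_neutral plus_fun_apply)
lemma homog_scale: "homog p q a \<Longrightarrow> homog p q (qscale c a)"
  by (auto simp: homog_def)
lemma subspace_homog: "qs.subspace {a. homog p q a}"
  by (rule qs.subspaceI) (auto intro: homog_add homog_scale simp: homog_zero)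
lemma homog_diff: "homog p q a \<Longrightarrow> homog p q b \<Longrightarrow> homog p q (a - b)"
  using qs.subspace_diff[OF subspace_homog] by auto
lemma homog_sum: "(\<And>i. i \<in> A \<Longrightarrow> homog p q (f i)) \<Longrightarrow> homog p q (\<Sum>i\<in>A. f i)"
  using qs.subspace_sum[OF subspace_homog, of A f] by auto

lemma pdeg_Un: "finite U \<Longrightarrow> S \<subseteq> U \<Longrightarrow> pdeg U = pdeg S + pdeg (U - S)"
  unfolding pdeg_def
  by (subst card_Un_disjoint[symmetric]) (auto intro: finite_subset arg_cong[where f=card])
lemma qdeg_Un: "finite U \<Longrightarrow> S \<subseteq> U \<Longrightarrow> qdeg U = qdeg S + qdeg (U - S)"
  unfolding qdeg_def
  by (subst card_Un_disjoint[symmetric]) (auto intro: finite_subset arg_cong[where f=card])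

lemma homog_wedge:
  assumes "homog p q a" "homog p' q' b" shows "homog (p + p') (q + q') (wedge a b)"
  unfolding homog_def
proof (intro allI impI)
  fix U assume "wedge a b U \<noteq> 0"
  then obtain S where "finite U" "S \<subseteq> U" "a S \<noteq> 0" "b (U - S) \<noteq> 0" by (rule wedge_nonzeroE)
  then show "pdeg U = p + p' \<and> qdeg U = q + q'"
    using assms by (auto simp: homog_def pdeg_Un qdeg_Un)
qed

lemma homog_genel: "homog (pdeg {g}) (qdeg {g}) (genel g)"
  by (simp add: homog_def genel_def mono_def)
lemma homog_one: "homog 0 0 one"
  by (simp add: homog_def one_def mono_def pdeg_def qdeg_def)

lemma pdeg_singleton: "pdeg {g} = (if fst g \<le> 1 then 1 else 0)"
proof -
  have "{h \<in> {g}. fst h \<le> 1} = (if fst g \<le> 1 then {g} else {})" by auto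
  then show ?thesis by (simp add: pdeg_def)
qed
lemma qdeg_singleton: "qdeg {g} = (if fst g = 2 then 1 else 0)"
proof -
  have "{h \<in> {g}. fst h = 2} = (if fst g = 2 then {g} else {})" by auto
  then show ?thesis by (simp add: qdeg_def)
qed

lemma homog_wprod_distinct:
  assumes "\<And>g. g \<in> set l \<Longrightarrow> homog (pdeg {g}) (qdeg {g}) (f g)" "distinct l"
  shows "homog (pdeg (set l)) (qdeg (set l)) (wprod (map f l))"
  using assms
proof (induction l)
  case Nil then show ?case by (simp add: homog_def one_def mono_def)
next
  case (Cons g l)
  have "homog (pdeg {g} + pdeg (set l)) (qdeg {g} + qdeg (set l)) (wedge (f g) (wprod (map f l)))"
    by (rule homog_wedge) (use Cons in auto)
  moreover have "insert g (set l) - {g} = set l" using Cons.prems by auto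
  ultimately show ?case
    using pdeg_Un[of "set (g # l)" "{g}"] qdeg_Un[of "set (g # l)" "{g}"] by simp
qed

lemma homog_alg_map:
  assumes "\<And>g. g \<in> gens n \<Longrightarrow> homog (pdeg {g}) (qdeg {g}) (f g)" "homog p q a"
  shows "homog p q (alg_map n f a)"
  unfolding alg_map_def
proof (intro homog_sum)
  fix S assume S: "S \<in> Pow (gens n)"
  show "homog p q (qscale (a S) (wprod (map f (sorted_list_of_set S))))"
  proof (cases "a S = 0")
    case True
    show ?thesis by (simp add: True homog_zero)
  next
    case False
    have "finite S" using S finite_subset[OF _ finite_gens] by blast
    then have "homog (pdeg S) (qdeg S) (wprod (map f (sorted_list_of_set S)))"
      using homog_wprod_distinct[of "sorted_list_of_set S" f] assms(1) S by auto
    then show ?thesis using False assms(2) by (auto simp: homog_def)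
  qed
qed

text \<open>\<open>Atil\<close> is spanned by bihomogeneous products. Projecting such a spanning
  family expresses a homogeneous element through the products of its own bidegree alone.\<close>

definition hproj :: "nat \<Rightarrow> nat \<Rightarrow> ext \<Rightarrow> ext" where
  "hproj p q a = (\<lambda>S. if pdeg S = p \<and> qdeg S = q then a S else 0)"

lemma qlin_hproj: "qlin (hproj p q)"
  by (rule qlinI) (auto simp: hproj_def fun_eq_iff)
lemma hproj_homog: "homog p q a \<Longrightarrow> hproj p' q' a = (if p' = p \<and> q' = q then a else 0)"
  by (auto simp: hproj_def homog_def fun_eq_iff)

subsection \<open>The substitution killing the boundaries\<close>

text \<open>Polynomial functions on an infinite field determine their coefficients. This lets the
  substitution use numbers s and t in place of formal variables.\<close>

lemma rat_poly_coeffs_eq: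
  fixes c d :: "nat \<Rightarrow> rat"
  assumes "\<And>s. (\<Sum>k\<le>p. s ^ k * c k) = (\<Sum>k\<le>p. s ^ k * d k)" "k \<le> p"
  shows "c k = d k"
proof -
  define P where "P = (\<Sum>k\<le>p. monom (c k) k)"
  define Q where "Q = (\<Sum>k\<le>p. monom (d k) k)"
  have "poly P s = poly Q s" for s
    using assms(1)[of s] by (simp add: P_def Q_def poly_sum poly_monom mult.commute)
  then have "P = Q" by (simp add: poly_eq_poly_eq_iff[symmetric] fun_eq_iff)
  then have "coeff P k = coeff Q k" by simp
  then show ?thesis using assms(2) by (simp add: P_def Q_def coeff_sum)
qed

text \<open>On x_i and y_i this is the identity on indices tensored with the functional (s,t) on
  Q^2; both land on multiples of the same x_i.\<close>

definition psi_gen :: "rat \<Rightarrow> rat \<Rightarrow> gen \<Rightarrow> ext" where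
  "psi_gen s t g = (case g of (f,i,j) \<Rightarrow>
     if f = 0 then qscale s (xg i) else if f = 1 then qscale t (xg i) else 0)"

definition psi :: "nat \<Rightarrow> rat \<Rightarrow> rat \<Rightarrow> ext \<Rightarrow> ext" where
  "psi n s t = alg_map n (psi_gen s t)"

definition xdeg :: "gen set \<Rightarrow> nat" where "xdeg T = card {g \<in> T. fst g = 0}"

text \<open>The component k collects the monomials with exactly k factors x_i, so that it is the
  coefficient of s^k t^(p-k) in psi n s t.\<close>

definition phi :: "nat \<Rightarrow> ext \<Rightarrow> (gen set \<times> nat \<Rightarrow> rat)" where
  "phi n a = (\<lambda>(S,k). \<Sum>T\<in>Pow (gens n). if xdeg T = k then a T * psi n 1 1 (mono T) S else 0)"

lemma deg1_psi_gen: "deg1 (psi_gen s t g)"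
  unfolding psi_gen_def xg_def by (auto split: prod.split intro!: deg1_scale)

lemma psi_gen_simps [simp]:
  "psi_gen s t (0,i,j) = qscale s (xg i)"
  "psi_gen s t (Suc 0,i,j) = qscale t (xg i)"
  "psi_gen s t (2,i,j) = 0"
  by (simp_all add: psi_gen_def)

lemma psi_gen_om: "fst g = 2 \<Longrightarrow> psi_gen s t g = 0"
  by (auto simp: psi_gen_def split: prod.split)

lemma x_gens: "i < n \<Longrightarrow> (0,i,0) \<in> gens n" and y_gens: "i < n \<Longrightarrow> (Suc 0,i,0) \<in> gens n"
  by (auto simp: gens_def)

lemma pgen_simps [simp]:
  "pgen \<sigma> (0,i,j) = (0,\<sigma> i,0)"
  "pgen \<sigma> (Suc 0,i,j) = (Suc 0,\<sigma> i,0)"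
  by (simp_all add: pgen_def)

lemma supp_xg: "i < n \<Longrightarrow> supp n (xg i)"
  unfolding xg_def by (rule supp_genel) (auto simp: gens_def)
lemma supp_yg: "i < n \<Longrightarrow> supp n (yg i)"
  unfolding yg_def by (rule supp_genel) (auto simp: gens_def)

lemma supp_psi_gen: "g \<in> gens n \<Longrightarrow> supp n (psi_gen s t g)"
  unfolding psi_gen_def gens_def by (auto intro!: supp_scale supp_xg simp: supp_zero)

lemma qlin_phi: "qlin (phi n)"
proof (rule qlinI)
  show "phi n (a + b) = phi n a + phi n b" for a b
    by (auto simp: phi_def fun_eq_iff sum.distrib[symmetric] distrib_right intro!: sum.cong)
  show "phi n (qscale c a) = qscale c (phi n a)" for c a
    by (auto simp: phi_def fun_eq_iff sum_distrib_left intro!: sum.cong)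
qed

lemma qlin_psi: "qlin (psi n s t)"
  unfolding psi_def by (rule qlin_alg_map)

lemma psi_mono:
  assumes T: "T \<subseteq> gens n"
  shows "psi n s t (mono T) = qscale (s ^ xdeg T * t ^ (pdeg T - xdeg T)) (psi n 1 1 (mono T))"
proof -
  \<comment> \<open>At omega generators \<open>psi_gen\<close> is 0, so any weight satisfies the
    scaling identity; the value 1 keeps them out of the product of weights.\<close>
  define w where "w g = (if fst g = 0 then s else if fst g = 1 then t else 1)" for g :: gen
  have fin: "finite T" using T finite_subset[OF _ finite_gens] by blast
  have w: "psi_gen s t g = qscale (w g) (psi_gen 1 1 g)" for g
    by (auto simp: psi_gen_def w_def fun_eq_iff split: prod.split)
  have "wprod (map (psi_gen s t) l) = qscale (prod_list (map w l)) (wprod (map (psi_gen 1 1) l))" for l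
  proof (induction l)
    case (Cons g l)
    then show ?case
      by (simp only: list.map foldr.simps o_apply prod_list.Cons w wedge_scale_left wedge_scale_right qs.scale_scale mult.commute)
  qed (simp add: fun_eq_iff)
  moreover have "prod_list (map w (sorted_list_of_set T)) = prod w T"
    using fin prod.distinct_set_conv_list[of "sorted_list_of_set T" w] by simp
  moreover have "prod w T = s ^ xdeg T * t ^ (pdeg T - xdeg T)"
  proof -
    have "prod w T = s ^ card {g \<in> T. fst g = 0} * t ^ card {g \<in> T. fst g = 1}"
      using fin
    proof (induction T)
      case (insert g T)
      have "{h \<in> insert g T. fst h = k} = (if fst g = k then insert g {h \<in> T. fst h = k} else {h \<in> T. fst h = k})" for k
        by auto
      then show ?case using insert by (auto simp: w_def)
    qed simp
    moreover have "pdeg T = xdeg T + card {g \<in> T. fst g = 1}"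
      unfolding pdeg_def xdeg_def using fin
      by (subst card_Un_disjoint[symmetric]) (auto intro!: arg_cong[where f=card])
    ultimately show ?thesis by (simp add: xdeg_def)
  qed
  ultimately show ?thesis unfolding psi_def using T by (simp only: alg_map_mono)
qed

lemma alg_map_apply:
  "alg_map n f a U = (\<Sum>S\<in>Pow (gens n). a S * alg_map n f (mono S) U)"
proof -
  have "alg_map n f a U = (\<Sum>S\<in>Pow (gens n). a S * wprod (map f (sorted_list_of_set S)) U)"
    by (simp add: alg_map_def sum_apply)
  also have "\<dots> = (\<Sum>S\<in>Pow (gens n). a S * alg_map n f (mono S) U)"
    by (rule sum.cong) (simp_all add: alg_map_mono)
  finally show ?thesis .
qed

lemma xdeg_le_pdeg: "finite T \<Longrightarrow> xdeg T \<le> pdeg T"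
  unfolding xdeg_def pdeg_def by (rule card_mono) auto

text \<open>Homogeneity forces \<open>pdeg T = p\<close> for each monomial T occurring in
  \<open>a\<close>, so the exponent of t is p minus the exponent of s.\<close>

lemma psi_phi:
  assumes "homog p 0 a"
  shows "psi n s t a S = (\<Sum>k\<le>p. s ^ k * t ^ (p - k) * phi n a (S,k))"
proof -
  have "psi n s t a S = (\<Sum>T\<in>Pow (gens n). \<Sum>k\<le>p. s ^ k * t ^ (p - k) *
      (if xdeg T = k then a T * psi n 1 1 (mono T) S else 0))"
    unfolding psi_def[of n s t] alg_map_apply[of n _ a S]
  proof (rule sum.cong[OF refl])
    fix T assume T: "T \<in> Pow (gens n)"
    show "a T * alg_map n (psi_gen s t) (mono T) S = (\<Sum>k\<le>p. s ^ k * t ^ (p - k) *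
      (if xdeg T = k then a T * psi n 1 1 (mono T) S else 0))"
    proof (cases "a T = 0")
      case False
      then have p: "pdeg T = p" using assms by (auto simp: homog_def)
      have x: "xdeg T \<le> p" using xdeg_le_pdeg[of T] T finite_subset[OF _ finite_gens] p by blast
      have "(\<Sum>k\<le>p. s ^ k * t ^ (p - k) * (if xdeg T = k then a T * psi n 1 1 (mono T) S else 0)) =
        (\<Sum>k\<le>p. if k = xdeg T then s ^ xdeg T * t ^ (p - xdeg T) * (a T * psi n 1 1 (mono T) S) else 0)"
        by (rule sum.cong) auto
      then show ?thesis using psi_mono[of T n s t] T x p by (simp add: psi_def[symmetric])
    qed (auto intro!: sum.neutral)
  qed
  also have "\<dots> = (\<Sum>k\<le>p. s ^ k * t ^ (p - k) * phi n a (S,k))"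
    by (subst sum.swap) (simp add: phi_def sum_distrib_left)
  finally show ?thesis .
qed

lemma phi_large:
  assumes "homog p 0 a" "p < k" shows "phi n a (S,k) = 0"
proof -
  have "(if xdeg T = k then a T * psi n 1 1 (mono T) S else 0) = 0" if "T \<in> Pow (gens n)" for T
    using assms that xdeg_le_pdeg[of T] finite_subset[OF _ finite_gens, of T n]
    by (auto simp: homog_def)
  then show ?thesis unfolding phi_def by (simp add: sum.neutral)
qed

text \<open>For a form of known degree p, setting t = 1 loses nothing. The components are then the
  coefficients of a polynomial function of s.\<close>

lemma phi_eqI:
  assumes "homog p 0 a" "k \<le> p" "\<And>s. psi n s 1 a S = (\<Sum>k\<le>p. s ^ k * c k)"
  shows "phi n a (S,k) = c k"
  by (rule rat_poly_coeffs_eq[OF _ assms(2)])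
     (use psi_phi[OF assms(1), of n _ 1 S] assms(3) in simp)

lemma phi_eq_zeroI:
  assumes "homog p 0 a" "\<And>s. psi n s 1 a = 0"
  shows "phi n a = 0"
proof
  fix x :: "gen set \<times> nat"
  obtain S k where x: "x = (S,k)" by force
  show "phi n a x = 0 x"
    unfolding x
    by (cases "k \<le> p") (use phi_eqI[OF assms(1), of k n S "\<lambda>_. 0"] phi_large[OF assms(1)] assms(2) in auto)
qed

subsection \<open>Equivariance\<close>

lemma pgen_in_gens:
  assumes "\<sigma> permutes {..<n}" "g \<in> gens n" shows "pgen \<sigma> g \<in> gens n"
proof -
  have m: "\<sigma> i < n" if "i < n" for i using assms(1) that permutes_in_image[of \<sigma> "{..<n}" i] by simp
  have i: "\<sigma> i \<noteq> \<sigma> j" if "i \<noteq> j" for i j using assms(1) that permutes_inj inj_eq by metis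
  show ?thesis
  proof (cases "fst g = 2")
    case True
    then obtain k l where "g = (2,k,l)" "k < l" "l < n" using assms(2) by (auto simp: gens_def)
    then show ?thesis using m[of k] m[of l] i[of k l] by (auto simp: pgen_def gens_def min_def max_def)
  next
    case False
    then show ?thesis using assms(2) m by (auto simp: gens_def pgen_def)
  qed
qed

lemma fst_pgen: "fst (pgen \<sigma> g) = fst g"
  by (auto simp: pgen_def split: prod.split)

abbreviation slact_gen :: "mat2 \<Rightarrow> gen \<Rightarrow> ext" where
  "slact_gen m \<equiv> (case m of (a,b,c,d) \<Rightarrow> (\<lambda>g. case g of (t,i,j) \<Rightarrow>
      if t = 0 then qscale a (xg i) + qscale c (yg i)
      else if t = 1 then qscale b (xg i) + qscale d (yg i)
      else genel g))"

lemma slact_eq: "slact n m = alg_map n (slact_gen m)"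
  by (cases m) (simp add: slact_def)

lemma supp_slact_gen: "g \<in> gens n \<Longrightarrow> supp n (slact_gen m g)"
  by (cases m) (auto simp: gens_def intro!: supp_add supp_scale supp_xg supp_yg supp_genel)

lemma homog_slact_gen: "g \<in> gens n \<Longrightarrow> homog (pdeg {g}) (qdeg {g}) (slact_gen m g)"
proof (cases m)
  case (fields a b c d)
  assume g: "g \<in> gens n"
  have x: "homog 1 0 (xg i)" for i unfolding xg_def
    using homog_genel[of "(0,i,0)"] by (simp add: pdeg_singleton qdeg_singleton)
  have y: "homog 1 0 (yg i)" for i unfolding yg_def
    using homog_genel[of "(1,i,0)"] by (simp add: pdeg_singleton qdeg_singleton)
  have o: "homog 0 1 (genel (2,i,j))" for i j
    using homog_genel[of "(2,i,j)"] by (simp add: pdeg_singleton qdeg_singleton)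
  show ?thesis using g x y o unfolding fields pdeg_singleton qdeg_singleton
    by (auto simp: gens_def intro!: homog_add homog_scale)
qed

lemma homog_act:
  assumes "\<sigma> permutes {..<n}" "homog p q a" shows "homog p q (act n (\<sigma>, m) a)"
  unfolding act_def permact_def slact_eq fst_conv snd_conv
proof (intro homog_alg_map assms)
  fix g assume "g \<in> gens n"
  then show "homog (pdeg {g}) (qdeg {g}) (slact_gen m g)" by (rule homog_slact_gen)
  show "homog (pdeg {g}) (qdeg {g}) (genel (pgen \<sigma> g))"
    using homog_genel[of "pgen \<sigma> g"] by (simp add: pdeg_singleton qdeg_singleton fst_pgen)
qed

text \<open>On generators, x_i goes to A x_i + C y_i and then to a multiple A s + C t of x with
  index \<sigma> i; likewise y_i gives B s + E t. A matrix thus acts by the change of parameters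
  that also defines the action on \<open>Vp\<close>.\<close>

lemma psi_act:
  assumes \<sigma>: "\<sigma> permutes {..<n}" and a: "supp n a"
  shows "psi n s t (act n (\<sigma>, (A,B,C,E)) a) = permact n \<sigma> (psi n (A * s + C * t) (B * s + E * t) a)"
proof -
  define m where "m = (A,B,C,E)"
  have sp: "supp n (genel (pgen \<sigma> g))" if "g \<in> gens n" for g
    using pgen_in_gens[OF \<sigma> that] by (rule supp_genel)
  have "psi n s t (act n (\<sigma>, m) a) = psi n s t (permact n \<sigma> (slact n m a))"
    by (simp add: act_def)
  also have "\<dots> = alg_map n (\<lambda>g. psi n s t (genel (pgen \<sigma> g))) (slact n m a)"
    unfolding psi_def permact_def slact_eq
    by (rule alg_map_compose) (auto intro: deg1_psi_gen sp supp_alg_map supp_slact_gen)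
  also have "\<dots> = alg_map n (\<lambda>g. psi_gen s t (pgen \<sigma> g)) (slact n m a)"
    by (rule alg_map_cong) (simp add: psi_def alg_map_genel pgen_in_gens[OF \<sigma>] deg1_psi_gen)
  also have "\<dots> = alg_map n (\<lambda>g. alg_map n (\<lambda>g. psi_gen s t (pgen \<sigma> g)) (slact_gen m g)) a"
    unfolding slact_eq
    by (rule alg_map_compose) (auto intro: deg1_psi_gen supp_slact_gen a)
  also have "\<dots> = alg_map n (\<lambda>g. permact n \<sigma> (psi_gen (A * s + C * t) (B * s + E * t) g)) a"
  proof (rule alg_map_cong)
    fix g assume g: "g \<in> gens n"
    have L: "alg_map n (\<lambda>g. psi_gen s t (pgen \<sigma> g)) (genel h) = psi_gen s t (pgen \<sigma> h)"
      if "h \<in> gens n" for h using that by (simp add: alg_map_genel deg1_psi_gen)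
    have R: "permact n \<sigma> (genel h) = genel (pgen \<sigma> h)" if "h \<in> gens n" for h
      using that unfolding permact_def by (simp add: alg_map_genel)
    consider i where "i < n" "g = (0,i,0)" | i where "i < n" "g = (1,i,0)"
      | i j where "i < j" "j < n" "g = (2,i,j)"
      using g by (auto simp: gens_def)
    then show "alg_map n (\<lambda>g. psi_gen s t (pgen \<sigma> g)) (slact_gen m g) =
        permact n \<sigma> (psi_gen (A * s + C * t) (B * s + E * t) g)"
    proof cases
      case 1
      have "alg_map n (\<lambda>g. psi_gen s t (pgen \<sigma> g)) (xg i) = qscale s (xg (\<sigma> i))"
        "alg_map n (\<lambda>g. psi_gen s t (pgen \<sigma> g)) (yg i) = qscale t (xg (\<sigma> i))"
        "permact n \<sigma> (xg i) = xg (\<sigma> i)"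
        using 1 unfolding xg_def yg_def
        by (simp_all add: L R x_gens y_gens psi_gen_simps pgen_simps) (simp_all add: xg_def)
      then show ?thesis
        using 1 unfolding m_def psi_gen_def[of "A * s + C * t"]
        by (simp add: qlin_add[OF qlin_alg_map] qlin_scale[OF qlin_alg_map] permact_def
             fun_eq_iff algebra_simps)
    next
      case 2
      have "alg_map n (\<lambda>g. psi_gen s t (pgen \<sigma> g)) (xg i) = qscale s (xg (\<sigma> i))"
        "alg_map n (\<lambda>g. psi_gen s t (pgen \<sigma> g)) (yg i) = qscale t (xg (\<sigma> i))"
        "permact n \<sigma> (xg i) = xg (\<sigma> i)"
        using 2 unfolding xg_def yg_def
        by (simp_all add: L R x_gens y_gens psi_gen_simps pgen_simps) (simp_all add: xg_def)
      then show ?thesis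
        using 2 unfolding m_def psi_gen_def[of "A * s + C * t"]
        by (simp add: qlin_add[OF qlin_alg_map] qlin_scale[OF qlin_alg_map] permact_def
             fun_eq_iff algebra_simps)
    next
      case 3
      have "alg_map n (\<lambda>g. psi_gen s t (pgen \<sigma> g)) (genel g) = 0"
        using 3 L[OF g] psi_gen_om[of "pgen \<sigma> g"] fst_pgen[of \<sigma> g] by simp
      then show ?thesis
        using 3 unfolding m_def psi_gen_def[of "A * s + C * t"]
        by (simp add: permact_def qlin_zero[OF qlin_alg_map])
    qed
  qed
  also have "\<dots> = permact n \<sigma> (psi n (A * s + C * t) (B * s + E * t) a)"
    unfolding psi_def permact_def
    by (rule alg_map_compose[symmetric]) (auto intro: supp_psi_gen a)
  finally show ?thesis unfolding m_def .
qed

section \<open>Binary forms and equivariance of the components\<close>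

text \<open>\<open>delta k\<close> stands for u^k v^(p-k), whose image is (A u + C v)^k (B u + E
  v)^(p-k), evaluated here at u = s, v = 1. The sums in \<open>slVp\<close> are the two binomial
  expansions, collected by the total exponent m of u.\<close>

lemma slVp_delta_poly:
  assumes "k \<le> p"
  shows "(\<Sum>m\<le>p. s ^ m * slVp p (A,B,C,E) (delta k) m) = (A * s + C) ^ k * (B * s + E) ^ (p - k)"
proof -
  define c where "c i j = of_nat (k choose i) * A ^ i * C ^ (k - i) *
     (of_nat ((p - k) choose j) * B ^ j * E ^ (p - k - j))" for i j
  have sl: "slVp p (A,B,C,E) (delta k) m = (\<Sum>i\<le>k. if i \<le> m \<and> m - i \<le> p - k then c i (m - i) else 0)"
    if "m \<le> p" for m
  proof -
    have "slVp p (A,B,C,E) (delta k) m = (\<Sum>k'\<le>p. if k' = k then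
        (\<Sum>i\<le>k. if i \<le> m \<and> m - i \<le> p - k then c i (m - i) else 0) else 0)"
      using that unfolding slVp_def prod.case if_P[OF that]
    proof (intro sum.cong refl)
      fix k'
      show "delta k k' * (\<Sum>i\<le>k'. if i \<le> m \<and> m - i \<le> p - k' then
          of_nat (k' choose i) * A ^ i * C ^ (k' - i) *
          of_nat ((p - k') choose (m - i)) * B ^ (m - i) * E ^ (p - k' - (m - i)) else 0) =
        (if k' = k then \<Sum>i\<le>k. if i \<le> m \<and> m - i \<le> p - k then c i (m - i) else 0 else 0)"
      proof (cases "k' = k")
        case True
        show ?thesis unfolding True delta_def by (simp add: c_def mult.assoc cong: sum.cong if_cong)
      qed (simp add: delta_def)
    qed
    then show ?thesis using assms by simp
  qed
  have "(\<Sum>m\<le>p. s ^ m * slVp p (A,B,C,E) (delta k) m) =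
     (\<Sum>m\<le>p. \<Sum>i\<le>k. if i \<le> m \<and> m - i \<le> p - k then s ^ m * c i (m - i) else 0)"
    by (rule sum.cong) (auto simp: sl sum_distrib_left intro!: sum.cong)
  also have "\<dots> = (\<Sum>i\<le>k. \<Sum>m\<le>p. if i \<le> m \<and> m - i \<le> p - k then s ^ m * c i (m - i) else 0)"
    by (rule sum.swap)
  also have "\<dots> = (\<Sum>i\<le>k. \<Sum>j\<le>p - k. s ^ (i + j) * c i j)"
  proof (rule sum.cong[OF refl])
    fix i assume i: "i \<in> {..k}"
    have "(\<Sum>m\<le>p. if i \<le> m \<and> m - i \<le> p - k then s ^ m * c i (m - i) else 0) =
      (\<Sum>m\<in>{m\<in>{..p}. i \<le> m \<and> m - i \<le> p - k}. s ^ m * c i (m - i))"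
      by (rule sum.inter_filter[symmetric]) simp
    \<comment> \<open>With j = m - i the bound m \<le> p holds automatically, since i \<le> k and j
      \<le> p - k.\<close>
    also have "\<dots> = (\<Sum>j\<le>p - k. s ^ (i + j) * c i j)"
      by (rule sum.reindex_bij_witness[where i = "\<lambda>j. i + j" and j = "\<lambda>m. m - i"])
         (use i assms in auto)
    finally show "(\<Sum>m\<le>p. if i \<le> m \<and> m - i \<le> p - k then s ^ m * c i (m - i) else 0) =
      (\<Sum>j\<le>p - k. s ^ (i + j) * c i j)" .
  qed
  also have "\<dots> = (\<Sum>i\<le>k. \<Sum>j\<le>p - k. (of_nat (k choose i) * (A * s) ^ i * C ^ (k - i)) *
     (of_nat ((p - k) choose j) * (B * s) ^ j * E ^ (p - k - j)))"
    by (simp add: c_def power_add power_mult_distrib mult_ac)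
  also have "\<dots> = (A * s + C) ^ k * (B * s + E) ^ (p - k)"
    by (simp add: binomial_ring sum_product)
  finally show ?thesis .
qed

text \<open>Components are read off on the line t = 1, but a matrix moves the point (s,1) to (A s +
  C, B s + E), off that line. This is why \<open>psi\<close> carries two parameters. Expanding the
  powers of the new parameters produces the matrix coefficients in \<open>tact\<close>.\<close>

lemma phi_act:
  assumes \<sigma>: "\<sigma> permutes {..<n}" and a: "supp n a" "homog p 0 a"
  shows "phi n (act n (\<sigma>, g) a) = tact n p (\<sigma>, g) (phi n a)"
proof
  fix x :: "gen set \<times> nat"
  obtain U m where x: "x = (U,m)" by force
  obtain A B C E where g: "g = (A,B,C,E)" by (cases g)
  note h = homog_act[OF \<sigma> a(2), of g]
  show "phi n (act n (\<sigma>, g) a) x = tact n p (\<sigma>, g) (phi n a) x"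
  proof (cases "m \<le> p")
    case False
    then show ?thesis using phi_large[OF h] unfolding x tact_def slVp_def g by simp
  next
    case True
    show ?thesis unfolding x
    proof (rule phi_eqI[OF h True])
      fix s
      define P where "P = (\<lambda>S. permact n \<sigma> (mono S) U)"
      have "psi n s 1 (act n (\<sigma>, g) a) U = (\<Sum>S\<in>Pow (gens n). psi n (A * s + C) (B * s + E) a S * P S)"
        using psi_act[OF \<sigma> a(1), of s 1 A B C E] unfolding g P_def permact_def
        by (simp add: alg_map_apply[symmetric])
      also have "\<dots> = (\<Sum>S\<in>Pow (gens n). \<Sum>k\<le>p. phi n a (S,k) * P S * ((A * s + C) ^ k * (B * s + E) ^ (p - k)))"
        by (simp add: psi_phi[OF a(2)] sum_distrib_left sum_distrib_right mult_ac)
      also have "\<dots> = (\<Sum>S\<in>Pow (gens n). \<Sum>k\<le>p. phi n a (S,k) * P S * (\<Sum>m\<le>p. s ^ m * slVp p g (delta k) m))"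
        by (intro sum.cong refl) (simp add: slVp_delta_poly g)
      also have "\<dots> = (\<Sum>S\<in>Pow (gens n). \<Sum>k\<le>p. \<Sum>m\<le>p. s ^ m * (phi n a (S,k) * P S * slVp p g (delta k) m))"
        by (simp add: sum_distrib_left mult_ac)
      also have "\<dots> = (\<Sum>S\<in>Pow (gens n). \<Sum>m\<le>p. \<Sum>k\<le>p. s ^ m * (phi n a (S,k) * P S * slVp p g (delta k) m))"
        by (intro sum.cong refl sum.swap)
      also have "\<dots> = (\<Sum>m\<le>p. \<Sum>S\<in>Pow (gens n). \<Sum>k\<le>p. s ^ m * (phi n a (S,k) * P S * slVp p g (delta k) m))"
        by (rule sum.swap)
      also have "\<dots> = (\<Sum>m\<le>p. s ^ m * tact n p (\<sigma>, g) (phi n a) (U,m))"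
        by (simp add: tact_def P_def sum_distrib_left)
      finally show "psi n s 1 (act n (\<sigma>, g) a) U = (\<Sum>m\<le>p. s ^ m * tact n p (\<sigma>, g) (phi n a) (U,m))" .
    qed
  qed
qed

subsection \<open>Rows 0 and 1 of the translation-invariant part\<close>

text \<open>For type f = 0 this is X_i = x_i - x_N, for f = 1 it is Y_i = y_i - y_N; it vanishes for i = N.\<close>

definition bas :: "nat \<Rightarrow> nat \<times> nat \<Rightarrow> ext" where
  "bas N e = genel (fst e, snd e, 0) - genel (fst e, N, 0)"

abbreviation idx :: "nat \<Rightarrow> (nat \<times> nat) set" where
  "idx N \<equiv> {0,1} \<times> {..<N}"

abbreviation bprod :: "nat \<Rightarrow> (nat \<times> nat) list \<Rightarrow> ext" where
  "bprod N l \<equiv> wprod (map (bas N) l)"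

definition xy_forms :: "nat \<Rightarrow> nat \<Rightarrow> ext set" where
  "xy_forms N q = qspan {bprod N l | l. length l = q \<and> set l \<subseteq> idx N}"

definition om_forms :: "nat \<Rightarrow> nat \<Rightarrow> ext set" where
  "om_forms N q = qspan {wedge (om i j) (bprod N l) | i j l. i < j \<and> j \<le> N \<and> length l = q \<and> set l \<subseteq> idx N}"

text \<open>Writing \<open>length l + 2 = p\<close> instead of \<open>length l = p - 2\<close> makes
  the spanning family empty for p < 2, where there are no boundaries.\<close>

definition d_forms :: "nat \<Rightarrow> nat \<Rightarrow> ext set" where
  "d_forms N p = qspan {wedge (domega (2,i,j)) (bprod N l) | i j l.
     i < j \<and> j \<le> N \<and> length l + 2 = p \<and> set l \<subseteq> idx N}"

lemma subspace_xy_forms: "qs.subspace (xy_forms N q)" and subspace_om_forms: "qs.subspace (om_forms N q)"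
  and subspace_d_forms: "qs.subspace (d_forms N p)"
  by (simp_all add: xy_forms_def om_forms_def d_forms_def)

lemma deg1_bas [simp]: "deg1 (bas N e)"
  unfolding bas_def by (intro deg1_diff deg1_genel)

lemma deg1_om [simp]: "deg1 (om i j)"
  by (simp add: om_def)

lemma bprod_in_xy_forms: "set l \<subseteq> idx N \<Longrightarrow> bprod N l \<in> xy_forms N (length l)"
  unfolding xy_forms_def by (rule qs.span_base) blast

lemma bas_wedge_xy_forms:
  assumes "f \<in> {0,1}" "i \<le> N" "u \<in> xy_forms N q"
  shows "wedge (bas N (f,i)) u \<in> xy_forms N (Suc q)"
proof (cases "i = N")
  case True
  then show ?thesis using qs.subspace_0[OF subspace_xy_forms] by (simp add: bas_def)
next
  case False
  then have e: "(f,i) \<in> idx N" using assms by auto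
  show ?thesis
  proof (rule qlin_span[OF qlin_wedge_right _ subspace_xy_forms assms(3)[unfolded xy_forms_def]])
    fix x assume "x \<in> {bprod N l |l. length l = q \<and> set l \<subseteq> idx N}"
    then obtain l where "x = bprod N l" "length l = q" "set l \<subseteq> idx N" by blast
    then show "wedge (bas N (f,i)) x \<in> xy_forms N (Suc q)"
      using bprod_in_xy_forms[of "(f,i) # l" N] e by simp
  qed
qed

lemma diff_wedge_xy_forms:
  assumes "f \<in> {0,1}" "i \<le> N" "j \<le> N" "u \<in> xy_forms N q"
  shows "wedge (genel (f,i,0) - genel (f,j,0)) u \<in> xy_forms N (Suc q)"
proof -
  have "genel (f,i,0) - genel (f,j,0) = bas N (f,i) - bas N (f,j)" by (simp add: bas_def)
  then show ?thesis
    by (simp only: wedge_diff_left)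
       (intro qs.subspace_diff[OF subspace_xy_forms] bas_wedge_xy_forms assms)
qed

lemma om_wedge_xy_forms:
  assumes "i < j" "j \<le> N" "u \<in> xy_forms N q" shows "wedge (om i j) u \<in> om_forms N q"
proof (rule qlin_span[OF qlin_wedge_right _ subspace_om_forms assms(3)[unfolded xy_forms_def]])
  fix x assume "x \<in> {bprod N l |l. length l = q \<and> set l \<subseteq> idx N}"
  then show "wedge (om i j) x \<in> om_forms N q"
    unfolding om_forms_def using assms(1,2) by (intro qs.span_base) blast
qed

lemma om_swap: "i \<noteq> j \<Longrightarrow> om i j = om (min i j) (max i j)"
  by (simp add: om_def)

lemma homog_om: "homog 0 1 (om i j)"
  unfolding om_def using homog_genel[of "(2, min i j, max i j)"]
  by (simp add: pdeg_singleton qdeg_singleton)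

lemma homog_genel_xy: "f \<in> {0,1} \<Longrightarrow> homog 1 0 (genel (f,i,j))"
  using homog_genel[of "(f,i,j)"] by (auto simp: pdeg_singleton qdeg_singleton)

lemma homog_bprod: "set l \<subseteq> idx N \<Longrightarrow> homog (length l) 0 (bprod N l)"
proof (induction l)
  case (Cons e l)
  have "homog 1 0 (bas N e)"
    unfolding bas_def by (intro homog_diff homog_genel_xy) (use Cons.prems in auto)
  then have "homog (1 + length l) (0 + 0) (wedge (bas N e) (bprod N l))"
    by (rule homog_wedge) (use Cons in auto)
  then show ?case by simp
qed (simp add: homog_one)

lemma supp_bas: "e \<in> idx N \<Longrightarrow> supp (Suc N) (bas N e)"
  by (auto simp: bas_def gens_def intro!: supp_diff supp_genel)

lemma supp_bprod: "set l \<subseteq> idx N \<Longrightarrow> supp (Suc N) (bprod N l)"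
  by (rule supp_wprod) (auto simp del: One_nat_def intro!: supp_bas)

lemma xy_forms_homog: "a \<in> xy_forms N p \<Longrightarrow> homog p 0 a"
proof -
  have "xy_forms N p \<subseteq> {a. homog p 0 a}"
    unfolding xy_forms_def by (rule qs.span_minimal[OF _ subspace_homog]) (clarify, rule homog_bprod)
  then show "a \<in> xy_forms N p \<Longrightarrow> homog p 0 a" by auto
qed

lemma xy_forms_supp: "a \<in> xy_forms N p \<Longrightarrow> supp (Suc N) a"
proof -
  have "xy_forms N p \<subseteq> {a. supp (Suc N) a}"
    unfolding xy_forms_def by (rule qs.span_minimal[OF _ subspace_supp]) (clarify, rule supp_bprod)
  then show "a \<in> xy_forms N p \<Longrightarrow> supp (Suc N) a" by auto
qed

lemma om_forms_homog: "a \<in> om_forms N p \<Longrightarrow> homog p 1 a"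
proof -
  have "homog (length l) 1 (wedge (om i j) (bprod N l))" if "set l \<subseteq> idx N" for i j l
    using homog_wedge[OF homog_om homog_bprod[OF that]] by simp
  then have "om_forms N p \<subseteq> {a. homog p 1 a}"
    unfolding om_forms_def by (intro qs.span_minimal[OF _ subspace_homog]) auto
  then show "a \<in> om_forms N p \<Longrightarrow> homog p 1 a" by auto
qed

section \<open>Bigraded pieces of the lifted subalgebra\<close>

lemma gensE_cases:
  assumes "g \<in> gensE (Suc N)"
  obtains (xy) f i j where "f \<in> {0,1}" "i \<le> N" "j \<le> N" "g = genel (f,i,0) - genel (f,j,0)"
  | (om) i j where "i < j" "j \<le> N" "g = om i j"
proof -
  consider i j where "i < Suc N" "j < Suc N" "g = xg i - xg j"
    | i j where "i < Suc N" "j < Suc N" "g = yg i - yg j"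
    | i j where "i < Suc N" "j < Suc N" "i \<noteq> j" "g = om i j"
    using assms unfolding gensE_def by blast
  then show thesis
  proof cases
    case (1 i j) then show ?thesis using xy[of 0 i j] by (simp add: xg_def)
  next
    case (2 i j) then show ?thesis using xy[of 1 i j] by (simp add: yg_def)
  next
    case (3 i j) then show ?thesis using om[of "min i j" "max i j"] om_swap[of i j] by auto
  qed
qed

text \<open>Boundaries in row 0 come from row 1, so these are the two rows to describe. In row 1 a
  new difference passes the single omega at the cost of a sign, which keeps the omega in
  front.\<close>

lemma prodsE_bigraded:
  assumes "a \<in> prodsE (Suc N)"
  shows "\<exists>p q. homog p q a \<and> (q = 0 \<longrightarrow> a \<in> xy_forms N p) \<and> (q = 1 \<longrightarrow> a \<in> om_forms N p)"
  using assms
proof (induction rule: prodsE.induct)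
  case one
  have "one \<in> xy_forms N 0" using bprod_in_xy_forms[of "[]" N] by simp
  then show ?case using homog_one by force
next
  case (step a g)
  then obtain p q where a: "homog p q a" "q = 0 \<Longrightarrow> a \<in> xy_forms N p" "q = 1 \<Longrightarrow> a \<in> om_forms N p" by blast
  from step.hyps(2) show ?case
  proof (cases rule: gensE_cases)
    case (xy f i j)
    have d: "deg1 g" unfolding xy by (intro deg1_diff deg1_genel)
    have "homog 1 0 g" unfolding xy(4) by (intro homog_diff homog_genel_xy xy(1))
    then have "homog (1 + p) (0 + q) (wedge g a)" using a(1) by (rule homog_wedge)
    moreover have "wedge g a \<in> xy_forms N (Suc p)" if "q = 0"
      using diff_wedge_xy_forms[OF xy(1-3) a(2)[OF that]] xy(4) by simp
    moreover have "wedge g a \<in> om_forms N (Suc p)" if "q = 1"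
    proof (rule qlin_span[OF qlin_wedge_right _ subspace_om_forms a(3)[OF that, unfolded om_forms_def]])
      fix x assume "x \<in> {wedge (om i j) (bprod N l) |i j l. i < j \<and> j \<le> N \<and> length l = p \<and> set l \<subseteq> idx N}"
      then obtain k m l where x: "x = wedge (om k m) (bprod N l)" "k < m" "m \<le> N" "length l = p" "set l \<subseteq> idx N"
        by blast
      have "wedge g x = - wedge (om k m) (wedge g (bprod N l))"
        unfolding x(1) by (rule wedge_left_anticommute[OF d deg1_om])
      moreover have "wedge g (bprod N l) \<in> xy_forms N (Suc p)"
        using diff_wedge_xy_forms[OF xy(1-3) bprod_in_xy_forms[OF x(5)]] xy(4) x(4) by simp
      ultimately show "wedge g x \<in> om_forms N (Suc p)"
        using om_wedge_xy_forms[OF x(2,3)] qs.subspace_neg[OF subspace_om_forms] by metis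
    qed
    ultimately show ?thesis by (intro exI[of _ "Suc p"] exI[of _ q]) simp
  next
    case (om i j)
    have "homog (0 + p) (1 + q) (wedge g a)" unfolding om(3) using homog_om a(1) by (rule homog_wedge)
    moreover have "wedge g a \<in> om_forms N p" if "q = 0"
      using om_wedge_xy_forms[OF om(1,2) a(2)[OF that]] om(3) by simp
    ultimately show ?thesis by (intro exI[of _ p] exI[of _ "Suc q"]) simp
  qed
qed

lemma Atil_homog_0: "a \<in> Atil (Suc N) \<Longrightarrow> homog p 0 a \<Longrightarrow> a \<in> xy_forms N p"
proof -
  assume a: "a \<in> Atil (Suc N)" "homog p 0 a"
  have "hproj p 0 a \<in> xy_forms N p"
  proof (rule qlin_span[OF qlin_hproj _ subspace_xy_forms a(1)[unfolded Atil_def]])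
    fix x assume "x \<in> prodsE (Suc N)"
    then obtain p' q' where "homog p' q' x" "q' = 0 \<longrightarrow> x \<in> xy_forms N p'" using prodsE_bigraded by blast
    then show "hproj p 0 x \<in> xy_forms N p"
      using hproj_homog[of p' q' x p 0] qs.subspace_0[OF subspace_xy_forms, of N p] by (auto split: if_splits)
  qed
  then show ?thesis using hproj_homog[OF a(2), of p 0] by simp
qed

lemma Atil_homog_1: "a \<in> Atil (Suc N) \<Longrightarrow> homog p 1 a \<Longrightarrow> a \<in> om_forms N p"
proof -
  assume a: "a \<in> Atil (Suc N)" "homog p 1 a"
  have "hproj p 1 a \<in> om_forms N p"
  proof (rule qlin_span[OF qlin_hproj _ subspace_om_forms a(1)[unfolded Atil_def]])
    fix x assume "x \<in> prodsE (Suc N)"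
    then obtain p' q' where "homog p' q' x" "q' = 1 \<longrightarrow> x \<in> om_forms N p'" using prodsE_bigraded by blast
    then show "hproj p 1 x \<in> om_forms N p"
      using hproj_homog[of p' q' x p 1] qs.subspace_0[OF subspace_om_forms, of N p] by (auto split: if_splits)
  qed
  then show ?thesis using hproj_homog[OF a(2), of p 1] by simp
qed

lemma bas_in_gensE: "e \<in> idx N \<Longrightarrow> bas N e \<in> gensE (Suc N)"
proof -
  assume "e \<in> idx N"
  then obtain i where i: "i < N" "e = (0,i) \<or> e = (1,i)" by auto
  have "xg i - xg N \<in> gensE (Suc N)" unfolding gensE_def
    by (rule UnI1, rule UnI1, rule CollectI, rule exI[of _ i], rule exI[of _ N]) (use i in simp)
  moreover have "yg i - yg N \<in> gensE (Suc N)" unfolding gensE_def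
    by (rule UnI1, rule UnI2, rule CollectI, rule exI[of _ i], rule exI[of _ N]) (use i in simp)
  ultimately show ?thesis using i(2) by (auto simp: bas_def xg_def yg_def)
qed

lemma om_in_gensE:
  assumes "i < j" "j < n" shows "om i j \<in> gensE n"
  unfolding gensE_def
  by (rule UnI2, rule CollectI, rule exI[of _ i], rule exI[of _ j]) (use assms in simp)

lemma bprod_in_prodsE: "set l \<subseteq> idx N \<Longrightarrow> bprod N l \<in> prodsE (Suc N)"
proof (induction l)
  case (Cons e l)
  then show ?case using prodsE.step[of "bprod N l" "Suc N" "bas N e"] bas_in_gensE[of e N] by simp
qed (simp add: prodsE.one)

lemma xy_forms_subset_Atil: "xy_forms N p \<subseteq> Atil (Suc N)"
  unfolding xy_forms_def Atil_def by (rule qs.span_mono) (use bprod_in_prodsE in blast)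

lemma om_forms_subset_Atil: "om_forms N p \<subseteq> Atil (Suc N)"
  unfolding om_forms_def Atil_def
proof (rule qs.span_mono, clarify)
  fix i j l assume "i < j" "j \<le> N" "set l \<subseteq> idx N"
  then show "wedge (om i j) (bprod N l) \<in> prodsE (Suc N)"
    by (intro prodsE.step bprod_in_prodsE om_in_gensE) auto
qed

lemma Atil_om_forms: "{c \<in> Atil (Suc N). homog p 1 c} = om_forms N p"
  using Atil_homog_1 om_forms_homog om_forms_subset_Atil by blast

subsection \<open>The differential\<close>

lemma qlin_D: "qlin (D n)"
proof (rule qlinI)
  show "D n (a + b) = D n a + D n b" for a b
    unfolding D_def by (simp add: qs.scale_left_distrib sum.distrib)
  show "D n (qscale c a) = qscale c (D n a)" for c a
    unfolding D_def qs.scale_sum_right by simp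
qed

lemma D_mono:
  assumes "S \<subseteq> gens n" shows "D n (mono S) = Dmono S"
proof -
  have "D n (mono S) = (\<Sum>T\<in>Pow (gens n). if T = S then Dmono S else 0)"
    unfolding D_def by (rule sum.cong) (auto simp: mono_def)
  then show ?thesis using assms by simp
qed

lemma qdeg_zero_iff: "finite S \<Longrightarrow> qdeg S = 0 \<longleftrightarrow> (\<forall>g\<in>S. fst g \<noteq> 2)"
  unfolding qdeg_def by (subst card_0_eq) (simp, blast)

lemma D_homog_0:
  assumes "homog p 0 a" shows "D n a = 0"
  unfolding D_def
proof (rule sum.neutral, intro ballI)
  fix S assume S: "S \<in> Pow (gens n)"
  show "qscale (a S) (Dmono S) = 0"
  proof (cases "a S = 0")
    case False
    then have "qdeg S = 0" using assms by (simp add: homog_def)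
    then have "{g \<in> S. fst g = 2} = {}"
      using S finite_subset[OF _ finite_gens, of S n] qdeg_zero_iff[of S] by blast
    then have "Dmono S = 0" unfolding Dmono_def by (simp only: sum.empty)
    then show ?thesis by simp
  qed simp
qed

lemma fst_gens: "g \<in> gens n \<Longrightarrow> fst g \<le> 2"
  by (auto simp: gens_def)

text \<open>The tag 2 makes omega generators the largest in lexicographic order. Sorting omega_ij
  behind a monomial S without omegas costs (-1)^|S|; the derivation rule contributes the same sign,
  and the two cancel. The differentiated factor remains on the right.\<close>

lemma D_om_wedge:
  assumes ij: "i < j" "j < n" and u: "supp n u" "homog q 0 u"
  shows "D n (wedge (om i j) u) = wedge u (domega (2,i,j))"
proof (rule qlin_eq_on_supp[OF _ _ _ u(1)])
  show "qlin (\<lambda>u. D n (wedge (om i j) u))" "qlin (\<lambda>u. wedge u (domega (2,i,j)))"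
    by (intro qlin_compose[OF qlin_D qlin_wedge_right] qlin_wedge_left)+
  fix S assume S: "S \<subseteq> gens n" "u S \<noteq> 0"
  define g :: gen where "g = (2,i,j)"
  have fin: "finite S" using S finite_subset[OF _ finite_gens] by blast
  have "qdeg S = 0" using S(2) u(2) by (simp add: homog_def)
  then have ne: "fst h \<noteq> 2" if "h \<in> S" for h using that fin qdeg_zero_iff by blast
  have lt: "h < g" if "h \<in> S" for h
    using ne[OF that] fst_gens[of h n] S that by (cases h) (auto simp: g_def)
  have gS: "g \<notin> S" using ne[of g] by (auto simp: g_def)
  have gn: "g \<in> gens n" using ij by (auto simp: g_def gens_def)
  have om: "om i j = mono {g}" using ij by (simp add: om_def genel_def g_def)
  have "{t \<in> S. t < g} = S" using lt by blast
  then have 1: "wedge (om i j) (mono S) = qscale ((-1) ^ card S) (mono (insert g S))"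
    using gS fin unfolding om by (simp add: wedge_mono ksign_singleton_left)
  have a: "{h \<in> insert g S. fst h = 2} = {g}" using ne by (force simp only: g_def fst_conv)
  have b: "{h \<in> insert g S. h < g} = S" using lt by blast
  have c: "{h \<in> insert g S. g < h} = {}" using lt by (blast dest: less_not_sym)
  have "Dmono (insert g S) = qscale ((-1) ^ card S) (wedge (wedge (mono S) (domega g)) (mono {}))"
    unfolding Dmono_def a by (simp only: sum.insert[OF finite.emptyI] sum.empty empty_iff not_False_eq_True b c add_0_right)
  also have "wedge (wedge (mono S) (domega g)) (mono {}) = wedge (mono S) (domega g)"
    unfolding one_def[symmetric] by (rule wedge_one_right) (rule wedge_infinite)
  finally have 2: "Dmono (insert g S) = qscale ((-1) ^ card S) (wedge (mono S) (domega g))" .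
  have "D n (wedge (om i j) (mono S)) = qscale ((-1) ^ card S) (Dmono (insert g S))"
    unfolding 1 qlin_scale[OF qlin_D] using S(1) gn by (simp add: D_mono)
  also have "\<dots> = wedge (mono S) (domega g)"
    unfolding 2 qs.scale_scale power_add[symmetric] by simp
  finally show "D n (wedge (om i j) (mono S)) = wedge (mono S) (domega (2,i,j))"
    by (simp add: g_def)
qed

text \<open>An element of even degree is central: each factor of the list is passed twice, and the
  signs cancel.\<close>

lemma wedge2_commute:
  assumes "deg1 a" "deg1 b" "\<And>x. x \<in> set l \<Longrightarrow> deg1 x"
  shows "wedge (wedge a b) (wprod l) = wedge (wprod l) (wedge a b)"
  using assms(3)
proof (induction l)
  case Nil
  then show ?case by (simp add: wedge_one_right wedge_one_left wedge_infinite)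
next
  case (Cons c l)
  have c: "deg1 c" using Cons.prems by simp
  have "wedge (wedge a b) (wprod (c # l)) = wedge a (wedge b (wedge c (wprod l)))"
    by (simp add: wedge_assoc)
  also have "\<dots> = wedge a (- wedge c (wedge b (wprod l)))"
    by (simp only: wedge_left_anticommute[OF assms(2) c])
  also have "\<dots> = wedge c (wedge a (wedge b (wprod l)))"
    by (simp only: wedge_minus_right wedge_left_anticommute[OF assms(1) c] minus_minus)
  also have "\<dots> = wedge c (wedge (wprod l) (wedge a b))"
    using Cons by (simp add: wedge_assoc)
  finally show ?case by (simp add: wedge_assoc)
qed

lemma domega_eq: "domega (2,i,j) = wedge (bas N (0,i) - bas N (0,j)) (bas N (1,i) - bas N (1,j))"
  by (simp add: domega_def bas_def xg_def yg_def)

lemma domega_commute: "wedge (domega (2,i,j)) (bprod N l) = wedge (bprod N l) (domega (2,i,j))"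
  unfolding domega_eq[of i j N] by (rule wedge2_commute) (auto intro: deg1_diff)

lemma D_om_bprod:
  assumes "i < j" "j \<le> N" "set l \<subseteq> idx N"
  shows "D (Suc N) (wedge (om i j) (bprod N l)) = wedge (domega (2,i,j)) (bprod N l)"
  unfolding domega_commute
  by (rule D_om_wedge[OF _ _ supp_bprod[OF assms(3)] homog_bprod[OF assms(3)]]) (use assms in auto)

section \<open>Cycles and boundaries in row 0\<close>

lemma Zc_eq: "Zc (Suc N) p 0 = xy_forms N p"
proof
  show "Zc (Suc N) p 0 \<subseteq> xy_forms N p" unfolding Zc_def using Atil_homog_0 by blast
  show "xy_forms N p \<subseteq> Zc (Suc N) p 0"
  proof
    fix a assume a: "a \<in> xy_forms N p"
    have "D (Suc N) a \<in> Iid (Suc N)"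
      unfolding D_homog_0[OF xy_forms_homog[OF a]] Iid_def by (rule qs.span_zero)
    then show "a \<in> Zc (Suc N) p 0"
      using a xy_forms_homog xy_forms_subset_Atil unfolding Zc_def by blast
  qed
qed

text \<open>Each relation contains an omega, and multiplication never lowers the number of omegas.
  Hence E_2 in row 0 is the lifted algebra itself.\<close>

lemma Iid_homog_0:
  assumes "b \<in> Iid n" "homog p 0 b" shows "b = 0"
proof -
  let ?V = "{a. \<forall>S. qdeg S = 0 \<longrightarrow> a S = (0::rat)}"
  have sub: "qs.subspace ?V" by (rule qs.subspaceI) auto
  have "Iid n \<subseteq> ?V"
    unfolding Iid_def
  proof (rule qs.span_minimal[OF _ sub], clarify)
    fix S T r and U :: "gen set" assume r: "r \<in> rels n" and U: "qdeg U = 0"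
    have "\<exists>p' q'. homog p' (Suc q') r"
    proof -
      have x: "homog 1 0 (xg i - xg j)" "homog 1 0 (yg i - yg j)" for i j
        unfolding xg_def yg_def by (intro homog_diff homog_genel_xy; simp)+
      have "homog 1 1 (wedge (xg i - xg j) (om i j))" "homog 1 1 (wedge (yg i - yg j) (om i j))" for i j
        using homog_wedge[OF x(1) homog_om] homog_wedge[OF x(2) homog_om] by simp_all
      moreover have "homog 0 2 (wedge (om i j) (om j k) + wedge (om j k) (om k i) + wedge (om k i) (om i j))" for i j k
      proof -
        have "homog (0+0) (1+1) (wedge (om a b) (om c d))" for a b c d
          by (rule homog_wedge[OF homog_om homog_om])
        then show ?thesis by (intro homog_add) (simp_all only: add_0 one_add_one)
      qed
      ultimately have "homog 1 (Suc 0) r \<or> homog 0 (Suc 1) r"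
        using r unfolding rels_def by (auto simp: numeral_2_eq_2)
      then show ?thesis by blast
    qed
    then obtain p' q' where r': "homog p' (Suc q') r" by blast
    have m: "homog (pdeg X) (qdeg X) (mono X)" for X by (simp add: homog_def mono_def)
    have "homog (pdeg S + p' + pdeg T) (qdeg S + Suc q' + qdeg T) (wedge (wedge (mono S) r) (mono T))"
      by (intro homog_wedge m r')
    then show "wedge (wedge (mono S) r) (mono T) U = 0"
      using U unfolding homog_def by fastforce
  qed
  then have b: "b S = 0" if "qdeg S = 0" for S using assms(1) that by blast
  show ?thesis
  proof
    fix S show "b S = 0 S" using b[of S] assms(2) unfolding homog_def zero_fun_apply by metis
  qed
qed

lemma qlin_image_subspace:
  assumes "qlin f" "qs.subspace V" shows "qs.subspace (f ` V)"
proof (rule qs.subspaceI)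
  show "0 \<in> f ` V"
    using qlin_zero[OF assms(1)] qs.subspace_0[OF assms(2)] by (metis image_eqI)
  show "x + y \<in> f ` V" if "x \<in> f ` V" "y \<in> f ` V" for x y
    using that qlin_add[OF assms(1)] qs.subspace_add[OF assms(2)] by (metis (no_types, lifting) image_iff)
  show "qscale c x \<in> f ` V" if "x \<in> f ` V" for c x
    using that qlin_scale[OF assms(1)] qs.subspace_scale[OF assms(2)] by (metis (no_types, lifting) image_iff)
qed

lemma D_om_forms: "D (Suc N) ` om_forms N p = d_forms N (p + 2)"
proof
  show "D (Suc N) ` om_forms N p \<subseteq> d_forms N (p + 2)"
  proof (rule image_subsetI)
    fix c assume c: "c \<in> om_forms N p"
    show "D (Suc N) c \<in> d_forms N (p + 2)"
    proof (rule qlin_span[OF qlin_D _ subspace_d_forms c[unfolded om_forms_def]])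
      fix x assume "x \<in> {wedge (om i j) (bprod N l) |i j l. i < j \<and> j \<le> N \<and> length l = p \<and> set l \<subseteq> idx N}"
      then show "D (Suc N) x \<in> d_forms N (p + 2)"
        using D_om_bprod unfolding d_forms_def by (intro qs.span_base) fastforce
    qed
  qed
  show "d_forms N (p + 2) \<subseteq> D (Suc N) ` om_forms N p"
    unfolding d_forms_def
  proof (rule qs.span_minimal[OF _ qlin_image_subspace[OF qlin_D subspace_om_forms]], clarify)
    fix i j l assume *: "i < j" "j \<le> N" "length l + 2 = p + 2" "set l \<subseteq> idx N"
    have "wedge (om i j) (bprod N l) \<in> om_forms N p"
      unfolding om_forms_def by (rule qs.span_base) (use * in auto)
    then show "wedge (domega (2, i, j)) (bprod N l) \<in> D (Suc N) ` om_forms N p"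
      using D_om_bprod[OF *(1,2,4)] by (metis image_eqI)
  qed
qed

lemma Bd_eq: "Bd (Suc N) p 0 = d_forms N p"
proof -
  have I0: "0 \<in> Atil (Suc N) \<inter> Iid (Suc N)" by (simp add: Atil_def Iid_def qs.span_zero)
  have b: "{b. b \<in> Atil (Suc N) \<inter> Iid (Suc N) \<and> homog p 0 b} = {0}"
    using Iid_homog_0[of _ "Suc N" p] I0 homog_zero by blast
  have "Bd (Suc N) p 0 = {b + D (Suc N) c | b c. b \<in> {b. b \<in> Atil (Suc N) \<inter> Iid (Suc N) \<and> homog p 0 b} \<and>
      (if 2 \<le> p then c \<in> {c \<in> Atil (Suc N). homog (p - 2) 1 c} else c = 0)}"
    unfolding Bd_def by auto
  also have "\<dots> = {D (Suc N) c | c. if 2 \<le> p then c \<in> om_forms N (p - 2) else c = 0}"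
    unfolding b Atil_om_forms by (simp only: singleton_iff) (metis (no_types, opaque_lifting) add_0)
  also have "\<dots> = d_forms N p"
  proof (cases "2 \<le> p")
    case True
    then have "p - 2 + 2 = p" by simp
    then have "D (Suc N) ` om_forms N (p - 2) = d_forms N p" using D_om_forms[of N "p - 2"] by (simp only:)
    then show ?thesis unfolding if_P[OF True] by blast
  next
    case False
    then have "{wedge (domega (2,i,j)) (bprod N l) | i j l.
     i < j \<and> j \<le> N \<and> length l + 2 = p \<and> set l \<subseteq> idx N} = {}" by auto
    then have "d_forms N p = {0}" unfolding d_forms_def by (simp only: qs.span_empty)
    then show ?thesis using False qlin_zero[OF qlin_D] by simp
  qed
  finally show ?thesis .
qed

subsection \<open>Values on monomials\<close>

lemma psi_genel_xy:
  assumes "f \<in> {0,1}" "i < n"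
  shows "psi n s t (genel (f,i,0)) = qscale (if f = 0 then s else t) (xg i)"
proof -
  have g: "(f,i,0) \<in> gens n" using assms by (auto simp: gens_def)
  then show ?thesis
    using assms unfolding psi_def alg_map_genel[OF g deg1_psi_gen] by auto
qed

lemma psi_bas:
  assumes "f \<in> {0,1}" "i \<le> N"
  shows "psi (Suc N) s t (bas N (f,i)) = qscale (if f = 0 then s else t) (bas N (0,i))"
  using psi_genel_xy[OF assms(1), of _ "Suc N" s t] assms(2)
  by (simp only: bas_def qlin_diff[OF qlin_psi] fst_conv snd_conv xg_def less_Suc_eq_le
      order_refl qs.scale_right_diff_distrib)

abbreviation xcount :: "(nat \<times> nat) list \<Rightarrow> nat" where
  "xcount l \<equiv> length (filter (\<lambda>e. fst e = 0) l)"

abbreviation xpart :: "(nat \<times> nat) list \<Rightarrow> (nat \<times> nat) list" where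
  "xpart l \<equiv> map (\<lambda>e. (0, snd e)) l"

lemma psi_bprod:
  assumes "set l \<subseteq> idx N"
  shows "psi (Suc N) s 1 (bprod N l) = qscale (s ^ xcount l) (bprod N (xpart l))"
proof -
  have "psi (Suc N) s 1 (bprod N l) = wprod (map (psi (Suc N) s 1) (map (bas N) l))"
    unfolding psi_def
  proof (rule alg_map_wprod)
    fix a assume "a \<in> set (map (bas N) l)"
    then obtain e where "a = bas N e" "e \<in> set l" by auto
    then show "supp (Suc N) a" using assms supp_bas by blast
  qed (rule deg1_psi_gen)
  also have "\<dots> = qscale (s ^ xcount l) (bprod N (xpart l))"
    using assms
  proof (induction l)
    case Nil then show ?case by (simp add: fun_eq_iff)
  next
    case (Cons e l)
    obtain f i where e: "e = (f,i)" by force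
    then have fi: "f \<in> {0,1}" "i \<le> N" using Cons.prems by auto
    have "wprod (map (psi (Suc N) s 1) (map (bas N) l)) = qscale (s ^ xcount l) (bprod N (xpart l))"
      using Cons by auto
    then have "wprod (map (psi (Suc N) s 1) (map (bas N) (e # l))) =
       wedge (qscale (if f = 0 then s else 1) (bas N (0,i))) (qscale (s ^ xcount l) (bprod N (xpart l)))"
      using psi_bas[OF fi, of s 1] by (simp only: e list.map foldr.simps o_apply)
    also have "\<dots> = qscale ((if f = 0 then s else 1) * s ^ xcount l) (wedge (bas N (0,i)) (bprod N (xpart l)))"
      by (simp only: wedge_scale_left wedge_scale_right qs.scale_scale mult.commute)
    also have "(if f = 0 then s else 1) * s ^ xcount l = s ^ xcount (e # l)"
      by (simp add: e)
    finally show ?case by (simp add: e)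
  qed
  finally show ?thesis .
qed

text \<open>At t = 1 an X factor contributes s and a Y factor contributes 1, so a monomial lives in
  one component only, and the positions of its X factors leave no trace.\<close>

lemma phi_bprod:
  assumes "set l \<subseteq> idx N"
  shows "phi (Suc N) (bprod N l) (S,k) = (if k = xcount l then bprod N (xpart l) S else 0)"
proof (cases "k \<le> length l")
  case True
  show ?thesis
  proof (rule phi_eqI[OF homog_bprod[OF assms] True])
    fix s
    have "psi (Suc N) s 1 (bprod N l) S = s ^ xcount l * bprod N (xpart l) S"
      unfolding psi_bprod[OF assms] by simp
    also have "\<dots> = (\<Sum>k\<le>length l. if k = xcount l then s ^ xcount l * bprod N (xpart l) S else 0)"
      using length_filter_le[of "\<lambda>e. fst e = 0" l] by simp
    also have "\<dots> = (\<Sum>k\<le>length l. s ^ k * (if k = xcount l then bprod N (xpart l) S else 0))"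
      by (rule sum.cong) auto
    finally show "psi (Suc N) s 1 (bprod N l) S =
      (\<Sum>k\<le>length l. s ^ k * (if k = xcount l then bprod N (xpart l) S else 0))" .
  qed
next
  case False
  then have "k \<noteq> xcount l" using length_filter_le[of "\<lambda>e. fst e = 0" l] by auto
  then show ?thesis using phi_large[OF homog_bprod[OF assms]] False by simp
qed

lemma d_forms_subset_xy_forms: "d_forms N p \<subseteq> xy_forms N p"
  unfolding d_forms_def
proof (rule qs.span_minimal[OF _ subspace_xy_forms], clarify)
  fix i j l assume *: "i < j" "j \<le> N" "set l \<subseteq> idx N" "p = length l + 2"
  have "wedge (domega (2,i,j)) (bprod N l) =
    wedge (genel (0,i,0) - genel (0,j,0)) (wedge (genel (1,i,0) - genel (1,j,0)) (bprod N l))"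
    by (simp add: domega_def xg_def yg_def wedge_assoc)
  moreover have "wedge (genel (1,i,0) - genel (1,j,0)) (bprod N l) \<in> xy_forms N (Suc (length l))"
    by (rule diff_wedge_xy_forms[OF _ _ _ bprod_in_xy_forms[OF *(3)]]) (use * in auto)
  then have "wedge (genel (0,i,0) - genel (0,j,0)) (wedge (genel (1,i,0) - genel (1,j,0)) (bprod N l))
    \<in> xy_forms N (Suc (Suc (length l)))"
    by (rule diff_wedge_xy_forms[rotated 3]) (use * in auto)
  ultimately show "wedge (domega (2,i,j)) (bprod N l) \<in> xy_forms N (length l + 2)"
    by simp
qed

lemma phi_d_forms:
  assumes "a \<in> d_forms N p" shows "phi (Suc N) a = 0"
proof (rule phi_eq_zeroI)
  show "homog p 0 a" using assms d_forms_subset_xy_forms xy_forms_homog by blast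
  fix s
  have "psi (Suc N) s 1 a \<in> {0}"
  proof (rule qlin_span[OF qlin_psi _ qs.subspace_single_0 assms[unfolded d_forms_def]])
    fix x assume "x \<in> {wedge (domega (2,i,j)) (bprod N l) |i j l.
        i < j \<and> j \<le> N \<and> length l + 2 = p \<and> set l \<subseteq> idx N}"
    then obtain i j l where x: "x = wedge (domega (2,i,j)) (bprod N l)" "i < j" "j \<le> N" "set l \<subseteq> idx N"
      by blast
    \<comment> \<open>The X difference is sent to s v and the Y difference to v, so their product is
      a multiple of v v = 0.\<close>
    define v where "v = bas N (0,i) - bas N (0,j)"
    have sb: "supp (Suc N) (bas N (f,k))" if "f \<in> {0,1}" "k \<le> N" for f k
      using that by (auto simp: bas_def gens_def intro!: supp_diff supp_genel)
    have sv: "supp (Suc N) v" "supp (Suc N) (bas N (1,i) - bas N (1,j))"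
      unfolding v_def by (intro supp_diff sb; use x in simp)+
    have p0: "psi (Suc N) s 1 v = qscale s v"
      using psi_bas[of 0 i N s 1] psi_bas[of 0 j N s 1] x
      by (simp only: v_def qlin_diff[OF qlin_psi] qs.scale_right_diff_distrib) simp
    have p1: "psi (Suc N) s 1 (bas N (1,i) - bas N (1,j)) = v"
      using psi_bas[of 1 i N s 1] psi_bas[of 1 j N s 1] x
      by (simp only: v_def qlin_diff[OF qlin_psi]) simp
    have "psi (Suc N) s 1 (wedge v (bas N (1,i) - bas N (1,j))) =
        wedge (psi (Suc N) s 1 v) (psi (Suc N) s 1 (bas N (1,i) - bas N (1,j)))"
      unfolding psi_def by (rule alg_map_wedge[OF deg1_psi_gen sv])
    also have "\<dots> = wedge (qscale s v) v" by (simp only: p0 p1)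
    also have "\<dots> = 0"
      using wedge_self[of v] by (simp only: wedge_scale_left v_def deg1_diff deg1_bas qs.scale_zero_right)
    finally have "psi (Suc N) s 1 (domega (2,i,j)) = 0" by (simp only: domega_eq[of i j N] v_def)
    moreover have "psi (Suc N) s 1 x = wedge (psi (Suc N) s 1 (domega (2,i,j))) (psi (Suc N) s 1 (bprod N l))"
      unfolding x(1) psi_def domega_eq[of i j N]
      by (rule alg_map_wedge[OF deg1_psi_gen supp_wedge[OF sv[unfolded v_def]] supp_bprod[OF x(4)]])
    ultimately show "psi (Suc N) s 1 x \<in> {0}" by simp
  qed
  then show "psi (Suc N) s 1 a = 0" by simp
qed

subsection \<open>The image of the cycles\<close>

text \<open>The shape with all X factors in front, determined by an index list and the number k of X
  factors. For \<open>k > length cs\<close> it saturates at X factors only, hence the hypotheses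
  \<open>k \<le> length cs\<close> below.\<close>

definition typed :: "nat \<Rightarrow> nat list \<Rightarrow> (nat \<times> nat) list" where
  "typed k cs = map (Pair 0) (take k cs) @ map (Pair 1) (drop k cs)"

lemma typed_simps [simp]:
  "typed k [] = []"
  "typed 0 (c # cs) = (1,c) # typed 0 cs"
  "typed (Suc k) (c # cs) = (0,c) # typed k cs"
  by (simp_all add: typed_def)

lemma length_typed [simp]: "length (typed k cs) = length cs"
  by (simp add: typed_def)

lemma set_typed: "set cs \<subseteq> {..<N} \<Longrightarrow> set (typed k cs) \<subseteq> idx N"
  using set_take_subset[of k cs] set_drop_subset[of k cs] by (auto simp: typed_def)

lemma xcount_typed: "k \<le> length cs \<Longrightarrow> xcount (typed k cs) = k"
  by (simp add: typed_def filter_map o_def)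

lemma xpart_typed: "xpart (typed k cs) = map (Pair 0) cs"
  by (induction cs arbitrary: k) (simp, case_tac k, simp_all)

lemma phi_typed:
  assumes "set cs \<subseteq> {..<N}" "k \<le> length cs"
  shows "phi (Suc N) (bprod N (typed k cs)) (S,m) = (if m = k then bprod N (map (Pair 0) cs) S else 0)"
  using phi_bprod[OF set_typed[OF assms(1)], of k S m] by (simp only: xcount_typed[OF assms(2)] xpart_typed)

lemma bas_in_V1: "i < N \<Longrightarrow> bas N (0,i) \<in> V1 (Suc N)"
  unfolding V1_def
proof (rule CollectI, rule exI[of _ "\<lambda>j. (if j = i then 1 else 0) - (if j = N then 1 else 0)"], intro conjI)
  assume i: "i < N"
  show "(\<Sum>j<Suc N. (if j = i then 1 else 0) - (if j = N then 1 else (0::rat))) = 0"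
    using i by (simp add: sum_subtractf)
  have "(\<Sum>j<Suc N. qscale ((if j = i then 1 else 0) - (if j = N then 1 else 0)) (xg j)) =
    (\<Sum>j<Suc N. (if j = i then xg i else 0) - (if j = N then xg N else 0))"
    by (rule sum.cong) (use i in auto)
  also have "\<dots> = xg i - xg N" using i by (simp add: sum_subtractf)
  finally show "bas N (0, i) = (\<Sum>j<Suc N. qscale ((if j = i then 1 else 0) - (if j = N then 1 else 0)) (xg j))"
    by (simp add: bas_def xg_def)
qed

lemma V1_bas:
  assumes "v \<in> V1 (Suc N)"
  obtains c where "v = (\<Sum>i<N. qscale (c i) (bas N (0,i)))"
proof -
  obtain c where v: "v = (\<Sum>i<Suc N. qscale (c i) (xg i))" and c: "(\<Sum>i<Suc N. c i) = 0"
    using assms unfolding V1_def by blast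
  \<comment> \<open>The zero-sum condition solves for the coefficient of x_N, which turns each x_i
    into x_i - x_N.\<close>
  have cN: "c N = - (\<Sum>i<N. c i)" using c by (simp add: add_eq_0_iff2)
  have "v = (\<Sum>i<N. qscale (c i) (xg i)) + qscale (c N) (xg N)" unfolding v by simp
  also have "qscale (c N) (xg N) = - (\<Sum>i<N. qscale (c i) (xg N))"
    unfolding cN by (simp only: qs.scale_minus_left qs.scale_sum_left)
  also have "(\<Sum>i<N. qscale (c i) (xg i)) + - (\<Sum>i<N. qscale (c i) (xg N)) = (\<Sum>i<N. qscale (c i) (bas N (0,i)))"
    by (simp only: bas_def xg_def fst_conv snd_conv qs.scale_right_diff_distrib sum_subtractf add_uminus_conv_diff)
  finally show ?thesis by (rule that)
qed

definition x_forms :: "nat \<Rightarrow> nat \<Rightarrow> ext set" where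
  "x_forms N q = qspan {bprod N (map (Pair 0) cs) | cs. length cs = q \<and> set cs \<subseteq> {..<N}}"

lemma subspace_x_forms: "qs.subspace (x_forms N q)"
  by (simp add: x_forms_def)

text \<open>\<open>LamV1\<close> allows arbitrary vectors of V(1) as factors; expanding each of them
  in the basis X_i leaves finitely many products to consider.\<close>

lemma wprod_V1_in_x_forms: "set vs \<subseteq> V1 (Suc N) \<Longrightarrow> wprod vs \<in> x_forms N (length vs)"
proof (induction vs)
  case Nil
  show ?case unfolding x_forms_def by (rule qs.span_base) auto
next
  case (Cons v vs)
  then have IH: "wprod vs \<in> x_forms N (length vs)" and "v \<in> V1 (Suc N)" by auto
  then obtain c where v: "v = (\<Sum>i<N. qscale (c i) (bas N (0,i)))" using V1_bas by blast
  have "wedge (bas N (0,i)) (wprod vs) \<in> x_forms N (Suc (length vs))" if i: "i < N" for i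
  proof (rule qlin_span[OF qlin_wedge_right _ subspace_x_forms IH[unfolded x_forms_def]])
    fix x assume "x \<in> {bprod N (map (Pair 0) cs) | cs. length cs = length vs \<and> set cs \<subseteq> {..<N}}"
    then obtain cs where "x = bprod N (map (Pair 0) cs)" "length cs = length vs" "set cs \<subseteq> {..<N}" by blast
    then show "wedge (bas N (0,i)) x \<in> x_forms N (Suc (length vs))"
      unfolding x_forms_def using i by (intro qs.span_base CollectI exI[of _ "i # cs"]) auto
  qed
  then have "(\<Sum>i<N. qscale (c i) (wedge (bas N (0,i)) (wprod vs))) \<in> x_forms N (Suc (length vs))"
    by (intro qs.subspace_sum[OF subspace_x_forms] qs.subspace_scale[OF subspace_x_forms]) simp
  then show ?case unfolding v by (simp only: foldr.simps o_apply wedge_sum_left wedge_scale_left length_Cons)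
qed

lemma LamV1_subset_x_forms: "LamV1 (Suc N) p \<subseteq> x_forms N p"
  unfolding LamV1_def by (rule qs.span_minimal[OF _ subspace_x_forms]) (use wprod_V1_in_x_forms in auto)

lemma phi_image: "phi (Suc N) ` xy_forms N p = Tens (Suc N) p"
proof
  show "phi (Suc N) ` xy_forms N p \<subseteq> Tens (Suc N) p"
  proof (rule image_subsetI)
    fix a assume a: "a \<in> xy_forms N p"
    have sub: "qs.subspace (Tens (Suc N) p)" by (simp add: Tens_def)
    show "phi (Suc N) a \<in> Tens (Suc N) p"
    proof (rule qlin_span[OF qlin_phi _ sub a[unfolded xy_forms_def]])
      fix x assume "x \<in> {bprod N l |l. length l = p \<and> set l \<subseteq> idx N}"
      then obtain l where l: "x = bprod N l" "length l = p" "set l \<subseteq> idx N" by blast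
      have "phi (Suc N) x = (\<lambda>(S,k). bprod N (xpart l) S * delta (xcount l) k)"
        unfolding l(1) by (auto simp: fun_eq_iff phi_bprod[OF l(3)] delta_def)
      moreover have "delta (xcount l) \<in> Vp p"
        using length_filter_le[of "\<lambda>e. fst e = 0" l] l(2) by (auto simp: Vp_def delta_def)
      moreover have "bprod N (xpart l) \<in> LamV1 (Suc N) p"
        unfolding LamV1_def
      proof (rule qs.span_base, rule CollectI, rule exI[of _ "map (bas N) (xpart l)"], intro conjI refl)
        show "set (map (bas N) (xpart l)) \<subseteq> V1 (Suc N)"
          using l(3) bas_in_V1[of _ N] by auto
      qed (simp add: l(2))
      ultimately show "phi (Suc N) x \<in> Tens (Suc N) p"
        unfolding Tens_def by (intro qs.span_base) blast
    qed
  qed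
  have sub: "qs.subspace (phi (Suc N) ` xy_forms N p)"
    by (rule qlin_image_subspace[OF qlin_phi subspace_xy_forms])
  show "Tens (Suc N) p \<subseteq> phi (Suc N) ` xy_forms N p"
    unfolding Tens_def
  proof (rule qs.span_minimal[OF _ sub], clarify)
    fix w f assume w: "w \<in> LamV1 (Suc N) p" and f: "f \<in> Vp p"
    have ql: "qlin (\<lambda>w::ext. \<lambda>(S,k). w S * f k)"
      by (rule qlinI) (auto simp: fun_eq_iff algebra_simps)
    have w': "w \<in> x_forms N p" using w LamV1_subset_x_forms by blast
    show "(\<lambda>(S,k). w S * f k) \<in> phi (Suc N) ` xy_forms N p"
    proof (rule qlin_span[OF ql _ sub w'[unfolded x_forms_def]])
      fix x assume "x \<in> {bprod N (map (Pair 0) cs) |cs. length cs = p \<and> set cs \<subseteq> {..<N}}"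
      then obtain cs where cs: "x = bprod N (map (Pair 0) cs)" "length cs = p" "set cs \<subseteq> {..<N}" by blast
      \<comment> \<open>The preimage of a pure tensor: \<open>typed k cs\<close> has k X factors and
        therefore hits exactly \<open>delta k\<close>, so the coefficients of \<open>f\<close> serve
        as weights.\<close>
      have "(\<lambda>(S,k). x S * f k) = (\<Sum>k\<le>p. qscale (f k) (phi (Suc N) (bprod N (typed k cs))))"
      proof
        fix y :: "gen set \<times> nat"
        obtain S m where y: "y = (S,m)" by force
        have "(\<Sum>k\<le>p. qscale (f k) (phi (Suc N) (bprod N (typed k cs)))) (S,m) =
          (\<Sum>k\<le>p. if k = m then f m * x S else 0)"
          unfolding sum_apply qscale_apply
          by (rule sum.cong) (use cs in \<open>auto simp: phi_typed\<close>)
        also have "\<dots> = x S * f m" using f by (auto simp: Vp_def)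
        finally show "(case y of (S,k) \<Rightarrow> x S * f k) =
          (\<Sum>k\<le>p. qscale (f k) (phi (Suc N) (bprod N (typed k cs)))) y"
          by (simp only: y prod.case)
      qed
      moreover have "\<dots> \<in> phi (Suc N) ` xy_forms N p"
      proof (intro qs.subspace_sum[OF sub] qs.subspace_scale[OF sub] imageI)
        fix k show "bprod N (typed k cs) \<in> xy_forms N p"
          using bprod_in_xy_forms[OF set_typed[OF cs(3)], of k] by (simp only: length_typed cs(2))
      qed
      ultimately show "(\<lambda>(S,k). x S * f k) \<in> phi (Suc N) ` xy_forms N p" by (simp only:)
    qed
  qed
qed

subsection \<open>Straightening modulo boundaries\<close>

text \<open>\<open>domega\<close> is even, so the new factor slips behind it without a sign and
  joins the monomial. The boundaries are thus stable under multiplication from the left.\<close>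

lemma bas_wedge_d_forms:
  assumes e: "e \<in> idx N" and a: "a \<in> d_forms N q"
  shows "wedge (bas N e) a \<in> d_forms N (Suc q)"
proof (rule qlin_span[OF qlin_wedge_right _ subspace_d_forms a[unfolded d_forms_def]])
  fix x assume "x \<in> {wedge (domega (2,i,j)) (bprod N l) |i j l.
     i < j \<and> j \<le> N \<and> length l + 2 = q \<and> set l \<subseteq> idx N}"
  then obtain i j l where x: "x = wedge (domega (2,i,j)) (bprod N l)" "i < j" "j \<le> N"
      "length l + 2 = q" "set l \<subseteq> idx N" by blast
  have d: "deg1 (bas N (f,i) - bas N (f,j))" for f by (intro deg1_diff deg1_bas)
  have "wedge (bas N e) x = wedge (domega (2,i,j)) (wedge (bas N e) (bprod N l))"
    unfolding x(1) domega_eq[of i j N] wedge_assoc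
    by (simp only: wedge_left_anticommute[OF deg1_bas[of N e] d] wedge_minus_right minus_minus)
  then show "wedge (bas N e) x \<in> d_forms N (Suc q)"
    unfolding d_forms_def using x e
    by (intro qs.span_base CollectI exI[of _ i] exI[of _ j] exI[of _ "e # l"]) auto
qed

lemma domega_d_forms:
  assumes "i < j" "j \<le> N" "set l \<subseteq> idx N"
  shows "wedge (domega (2,i,j)) (bprod N l) \<in> d_forms N (length l + 2)"
  unfolding d_forms_def using assms by (intro qs.span_base) blast

text \<open>The boundary of omega with indices i and N is X_i Y_i itself, N being the subtracted
  index.\<close>

lemma same_index_d_forms:
  assumes "i < N" "set l \<subseteq> idx N"
  shows "wedge (bas N (0,i)) (wedge (bas N (1,i)) (bprod N l)) \<in> d_forms N (length l + 2)"
  using domega_d_forms[OF assms(1) order_refl assms(2)]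
  by (simp add: domega_def bas_def xg_def yg_def wedge_assoc)

text \<open>Polarisation: expand (X_i - X_j)(Y_i - Y_j) and remove X_i Y_i and X_j Y_j, which are
  boundaries already.\<close>

lemma swap_index_d_forms:
  assumes "i < N" "j < N" "i \<noteq> j" "set l \<subseteq> idx N"
  shows "wedge (bas N (0,i)) (wedge (bas N (1,j)) (bprod N l)) +
         wedge (bas N (0,j)) (wedge (bas N (1,i)) (bprod N l)) \<in> d_forms N (length l + 2)"
proof -
  have *: "wedge (bas N (0,i)) (wedge (bas N (1,j)) (bprod N l)) +
         wedge (bas N (0,j)) (wedge (bas N (1,i)) (bprod N l)) \<in> d_forms N (length l + 2)"
    if "i < j" "j < N" for i j
  proof -
    let ?u = "bprod N l"
    have "wedge (bas N (0,i)) (wedge (bas N (1,j)) ?u) + wedge (bas N (0,j)) (wedge (bas N (1,i)) ?u) =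
      wedge (bas N (0,i)) (wedge (bas N (1,i)) ?u) + wedge (bas N (0,j)) (wedge (bas N (1,j)) ?u) -
      wedge (domega (2,i,j)) ?u"
      unfolding domega_eq[of i j N] wedge_assoc wedge_diff_left wedge_diff_right
      by (simp only: algebra_simps)
    also have "\<dots> \<in> d_forms N (length l + 2)"
      by (intro qs.subspace_diff[OF subspace_d_forms] qs.subspace_add[OF subspace_d_forms]
          same_index_d_forms domega_d_forms assms(4)) (use that in auto)
    finally show ?thesis .
  qed
  show ?thesis
  proof (cases "i < j")
    case False
    then show ?thesis using *[of j i] assms by (simp only: add.commute)
  qed (use * assms in auto)
qed

text \<open>The lower bound m serves the insertion argument: when a factor of index c stays in
  front, the tail is straightened with bound \<open>Suc c\<close>, and the whole remains
  increasing.\<close>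

definition std_monomials :: "nat \<Rightarrow> nat \<Rightarrow> nat \<Rightarrow> nat \<Rightarrow> ext set" where
  "std_monomials N m q k = {bprod N (typed k cs) | cs. sorted_wrt (<) cs \<and> length cs = q \<and> set cs \<subseteq> {m..<N}}"

definition straight :: "nat \<Rightarrow> nat \<Rightarrow> nat \<Rightarrow> nat \<Rightarrow> ext set" where
  "straight N m q k = qspan (d_forms N q \<union> std_monomials N m q k)"

lemma subspace_straight: "qs.subspace (straight N m q k)"
  by (simp add: straight_def)

lemma d_forms_straight: "a \<in> d_forms N q \<Longrightarrow> a \<in> straight N m q k"
  unfolding straight_def by (rule qs.span_base) simp

lemma std_monomial_straight:
  "sorted_wrt (<) cs \<Longrightarrow> set cs \<subseteq> {m..<N} \<Longrightarrow> bprod N (typed k cs) \<in> straight N m (length cs) k"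
  unfolding straight_def std_monomials_def by (rule qs.span_base) blast

text \<open>An X factor may precede any normal form, a Y factor only one without X factors;
  \<open>fk\<close> records these two possibilities.\<close>

lemma straight_cons:
  assumes c: "c < N" "m \<le> c" and v: "v \<in> straight N (Suc c) q k"
    and fk: "f = 0 \<and> k' = Suc k \<or> f = 1 \<and> k = 0 \<and> k' = 0"
  shows "wedge (bas N (f,c)) v \<in> straight N m (Suc q) k'"
proof (rule qlin_span[OF qlin_wedge_right _ subspace_straight v[unfolded straight_def]])
  fix x assume "x \<in> d_forms N q \<union> std_monomials N (Suc c) q k"
  then show "wedge (bas N (f,c)) x \<in> straight N m (Suc q) k'"
  proof
    assume "x \<in> d_forms N q"
    then show ?thesis using c(1) fk by (intro d_forms_straight bas_wedge_d_forms) auto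
  next
    assume "x \<in> std_monomials N (Suc c) q k"
    then obtain cs where cs: "x = bprod N (typed k cs)" "sorted_wrt (<) cs" "length cs = q" "set cs \<subseteq> {Suc c..<N}"
      unfolding std_monomials_def by blast
    have "bprod N (typed k' (c # cs)) \<in> straight N m (length (c # cs)) k'"
      by (rule std_monomial_straight) (use cs c in force)+
    then show ?thesis using fk cs by auto
  qed
qed

text \<open>Modulo boundaries, exchanging the indices of neighbouring factors changes the sign whatever
  their types are, so a new factor can be moved to its sorted position; only the number k of
  X factors matters.\<close>

lemma insert_straight:
  assumes "sorted_wrt (<) cs" "k \<le> length cs" "f \<in> {0,1}" "i < N" "m \<le> i" "set cs \<subseteq> {m..<N}"
  shows "wedge (bas N (f,i)) (bprod N (typed k cs)) \<in> straight N m (Suc (length cs)) (if f = 0 then Suc k else k)"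
  using assms
proof (induction cs arbitrary: k f i m)
  case Nil
  have "bprod N (typed (if f = 0 then Suc k else k) [i]) \<in> straight N m (length [i]) (if f = 0 then Suc k else k)"
    by (rule std_monomial_straight) (use Nil in auto)
  then show ?case using Nil by (auto split: if_splits)
next
  case (Cons c cs)
  have cs: "sorted_wrt (<) cs" "set cs \<subseteq> {Suc c..<N}" "c < N" "m \<le> c"
    using Cons.prems by (auto simp: Suc_le_eq)
  have sl: "set (typed k cs) \<subseteq> idx N" for k by (rule set_typed) (use cs in auto)
  note neg = qs.subspace_neg[OF subspace_straight] and diff = qs.subspace_diff[OF subspace_straight]
  show ?case
  proof (cases "f = 0")
    case f: True
    consider "i < c" | "i = c" "k = 0" | k' where "i = c" "k = Suc k'" | "c < i" "k = 0"
      | k' where "c < i" "k = Suc k'" using linorder_less_linear[of i c] by (cases k) blast+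
    then show ?thesis
    proof cases
      case 1
      have "bprod N (typed (Suc k) (i # c # cs)) \<in> straight N m (length (i # c # cs)) (Suc k)"
        by (rule std_monomial_straight) (use Cons.prems 1 in auto)
      then show ?thesis using f by simp
    next
      case 2
      then show ?thesis using same_index_d_forms[OF cs(3) sl[of 0]] f by (intro d_forms_straight) simp
    next
      case (3 k')
      then have z: "wedge (bas N (f,i)) (bprod N (typed k (c # cs))) = 0"
        using f by (simp add: wedge_left_self)
      show ?thesis unfolding z by (rule qs.subspace_0[OF subspace_straight])
    next
      case 4
      let ?u = "bprod N (typed 0 cs)"
      \<comment> \<open>X_i Y_c is congruent to - X_c Y_i: the indices are exchanged while the types
        keep their places, and Y_i is then inserted into the tail.\<close>
      have r: "wedge (bas N (0,i)) (wedge (bas N (1,c)) ?u) + wedge (bas N (0,c)) (wedge (bas N (1,i)) ?u)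
          \<in> straight N m (Suc (Suc (length cs))) (Suc 0)"
        using swap_index_d_forms[of i N c "typed 0 cs"] Cons.prems cs 4 sl by (intro d_forms_straight) simp
      have "wedge (bas N (1,i)) ?u \<in> straight N (Suc c) (Suc (length cs)) (if (1::nat) = 0 then Suc 0 else 0)"
        by (rule Cons.IH) (use Cons.prems cs 4 in auto)
      then have "wedge (bas N (0,c)) (wedge (bas N (1,i)) ?u) \<in> straight N m (Suc (Suc (length cs))) (Suc 0)"
        by (intro straight_cons[OF cs(3,4)]) auto
      from diff[OF r this] show ?thesis using f 4 by simp
    next
      case (5 k')
      let ?u = "bprod N (typed k' cs)"
      have "wedge (bas N (0,i)) ?u \<in> straight N (Suc c) (Suc (length cs)) (if (0::nat) = 0 then Suc k' else k')"
        by (rule Cons.IH) (use Cons.prems cs 5 in auto)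
      then have "wedge (bas N (0,c)) (wedge (bas N (0,i)) ?u) \<in> straight N m (Suc (Suc (length cs))) (Suc (Suc k'))"
        by (intro straight_cons[OF cs(3,4)]) auto
      from neg[OF this] show ?thesis
        unfolding wedge_left_anticommute[of "bas N (0,i)" "bas N (0,c)" ?u, OF deg1_bas deg1_bas, symmetric]
        using f 5 by simp
    qed
  next
    case False
    then have f: "f = 1" using Cons.prems by simp
    consider "i < c" "k = 0" | "i = c" "k = 0" | "c < i" "k = 0"
      | k' where "i < c" "k = Suc k'" | k' where "i = c" "k = Suc k'" | k' where "c < i" "k = Suc k'"
      using linorder_less_linear[of i c] by (cases k) blast+
    then show ?thesis
    proof cases
      case 1
      have "bprod N (typed 0 (i # c # cs)) \<in> straight N m (length (i # c # cs)) 0"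
        by (rule std_monomial_straight) (use Cons.prems 1 in auto)
      then show ?thesis using f 1 by simp
    next
      case 2
      then have z: "wedge (bas N (f,i)) (bprod N (typed k (c # cs))) = 0"
        using f by (simp add: wedge_left_self)
      show ?thesis unfolding z by (rule qs.subspace_0[OF subspace_straight])
    next
      case 3
      let ?u = "bprod N (typed 0 cs)"
      have "wedge (bas N (1,i)) ?u \<in> straight N (Suc c) (Suc (length cs)) (if (1::nat) = 0 then Suc 0 else 0)"
        by (rule Cons.IH) (use Cons.prems cs 3 in auto)
      then have "wedge (bas N (1,c)) (wedge (bas N (1,i)) ?u) \<in> straight N m (Suc (Suc (length cs))) 0"
        by (intro straight_cons[OF cs(3,4)]) auto
      from neg[OF this] show ?thesis
        unfolding wedge_left_anticommute[of "bas N (1,i)" "bas N (1,c)" ?u, OF deg1_bas deg1_bas, symmetric]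
        using f 3 by simp
    next
      case (4 k')
      let ?u = "bprod N (typed k' cs)"
      \<comment> \<open>Here the indices are in order but the types are not. Y_i X_c = - X_c Y_i is
        congruent to X_i Y_c, so now i stays in front and Y_c is inserted into the tail, with lower
        bound \<open>Suc i\<close>.\<close>
      have r: "wedge (bas N (0,i)) (wedge (bas N (1,c)) ?u) + wedge (bas N (0,c)) (wedge (bas N (1,i)) ?u)
          \<in> straight N m (Suc (Suc (length cs))) (Suc k')"
        using swap_index_d_forms[of i N c "typed k' cs"] Cons.prems cs 4 sl by (intro d_forms_straight) simp
      have "wedge (bas N (1,c)) ?u \<in> straight N (Suc i) (Suc (length cs)) (if (1::nat) = 0 then Suc k' else k')"
        by (rule Cons.IH) (use Cons.prems cs 4 in auto)
      then have v: "wedge (bas N (0,i)) (wedge (bas N (1,c)) ?u) \<in> straight N m (Suc (Suc (length cs))) (Suc k')"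
        by (intro straight_cons[OF Cons.prems(4,5)]) auto
      have eq: "a - (a + b) = - b" for a b :: ext by simp
      from diff[OF v r] show ?thesis
        unfolding eq wedge_left_anticommute[of "bas N (1,i)" "bas N (0,c)" ?u, OF deg1_bas deg1_bas, symmetric]
        using f 4 by simp
    next
      case (5 k')
      let ?u = "bprod N (typed k' cs)"
      have "wedge (bas N (0,c)) (wedge (bas N (1,c)) ?u) \<in> straight N m (Suc (Suc (length cs))) (Suc k')"
        using same_index_d_forms[OF cs(3) sl[of k']] by (intro d_forms_straight) simp
      from neg[OF this] show ?thesis
        unfolding wedge_left_anticommute[of "bas N (1,c)" "bas N (0,c)" ?u, OF deg1_bas deg1_bas, symmetric]
        using f 5 by simp
    next
      case (6 k')
      let ?u = "bprod N (typed k' cs)"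
      have "wedge (bas N (1,i)) ?u \<in> straight N (Suc c) (Suc (length cs)) (if (1::nat) = 0 then Suc k' else k')"
        by (rule Cons.IH) (use Cons.prems cs 6 in auto)
      then have "wedge (bas N (0,c)) (wedge (bas N (1,i)) ?u) \<in> straight N m (Suc (Suc (length cs))) (Suc k')"
        by (intro straight_cons[OF cs(3,4)]) auto
      from neg[OF this] show ?thesis
        unfolding wedge_left_anticommute[of "bas N (1,i)" "bas N (0,c)" ?u, OF deg1_bas deg1_bas, symmetric]
        using f 6 by simp
    qed
  qed
qed

lemma bprod_straighten:
  assumes "set l \<subseteq> idx N"
  shows "bprod N l \<in> qspan (d_forms N (length l) \<union> (\<Union>k\<le>length l. std_monomials N 0 (length l) k))"
  using assms
proof (induction l)
  case Nil
  have "one \<in> std_monomials N 0 0 0" unfolding std_monomials_def by simp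
  then show ?case by (intro qs.span_base) simp
next
  case (Cons e l)
  let ?T = "qspan (d_forms N (length (e # l)) \<union> (\<Union>k\<le>length (e # l). std_monomials N 0 (length (e # l)) k))"
  have sub: "qs.subspace ?T" by (rule qs.subspace_span)
  have IH: "bprod N l \<in> qspan (d_forms N (length l) \<union> (\<Union>k\<le>length l. std_monomials N 0 (length l) k))"
    by (rule Cons.IH) (use Cons.prems in simp)
  obtain f i where e: "e = (f,i)" by force
  then have fi: "f \<in> {0,1}" "i < N" using Cons.prems by auto
  have "wedge (bas N e) (bprod N l) \<in> ?T"
  proof (rule qlin_span[OF qlin_wedge_right _ sub IH])
    fix x assume "x \<in> d_forms N (length l) \<union> (\<Union>k\<le>length l. std_monomials N 0 (length l) k)"
    then consider "x \<in> d_forms N (length l)" | k where "k \<le> length l" "x \<in> std_monomials N 0 (length l) k" by blast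
    then show "wedge (bas N e) x \<in> ?T"
    proof cases
      case 1
      have "e \<in> idx N" using Cons.prems by simp
      then show ?thesis using bas_wedge_d_forms[of e N x "length l"] 1 by (intro qs.span_base) simp
    next
      case (2 k)
      then obtain cs where cs: "x = bprod N (typed k cs)" "sorted_wrt (<) cs" "length cs = length l" "set cs \<subseteq> {0..<N}"
        unfolding std_monomials_def by blast
      define k' where "k' = (if f = 0 then Suc k else k)"
      have "wedge (bas N e) x \<in> straight N 0 (length (e # l)) k'"
        using insert_straight[OF cs(2) _ fi, of k 0] cs 2 by (simp add: e k'_def)
      moreover have "k' \<le> length (e # l)" using 2 by (simp add: k'_def)
      then have "d_forms N (length (e # l)) \<union> std_monomials N 0 (length (e # l)) k' \<subseteq>
          d_forms N (length (e # l)) \<union> (\<Union>k\<le>length (e # l). std_monomials N 0 (length (e # l)) k)" by blast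
      then have "straight N 0 (length (e # l)) k' \<subseteq> ?T" unfolding straight_def by (rule qs.span_mono)
      ultimately show ?thesis by blast
    qed
  qed
  then show ?case by (simp only: list.map foldr.simps o_apply)
qed

lemma xy_forms_straighten: "xy_forms N p \<subseteq> qspan (d_forms N p \<union> (\<Union>k\<le>p. std_monomials N 0 p k))"
  unfolding xy_forms_def
  by (rule qs.span_minimal[OF _ qs.subspace_span]) (use bprod_straighten in blast)

subsection \<open>Linear independence\<close>

lemma wedge_cong_right:
  assumes "\<And>T. T \<subseteq> S \<Longrightarrow> b T = b' T" shows "wedge a b S = wedge a b' S"
  unfolding wedge_def by (rule sum.cong) (use assms in auto)

lemma wedge_genel_outside: "g \<notin> S \<Longrightarrow> wedge (genel g) a S = 0"
  unfolding wedge_def genel_def mono_def by (rule sum.neutral) auto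

text \<open>Every term containing the subtracted x_N is supported on sets containing it. On other
  sets the factor x_c - x_N therefore acts as x_c.\<close>

lemma bprod_restrict:
  "(0,N,0) \<notin> S \<Longrightarrow> bprod N (map (Pair 0) cs) S = wprod (map xg cs) S"
proof (induction cs arbitrary: S)
  case (Cons c cs)
  have "bprod N (map (Pair 0) (c # cs)) S =
      wedge (xg c) (bprod N (map (Pair 0) cs)) S - wedge (genel (0,N,0)) (bprod N (map (Pair 0) cs)) S"
    by (simp add: bas_def wedge_diff_left xg_def)
  also have "\<dots> = wedge (xg c) (bprod N (map (Pair 0) cs)) S"
    using Cons.prems by (simp add: wedge_genel_outside)
  also have "\<dots> = wedge (xg c) (wprod (map xg cs)) S"
    by (rule wedge_cong_right) (use Cons in blast)
  finally show ?case by simp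
qed simp

abbreviation xset :: "nat set \<Rightarrow> gen set" where
  "xset C \<equiv> (\<lambda>i. (0,i,0)) ` C"

text \<open>Sending i to x_i preserves the order, so sorted indices give sorted generators and no
  sign.\<close>

lemma wprod_xg_sorted:
  assumes "finite C"
  shows "wprod (map xg (sorted_list_of_set C)) = mono (xset C)"
proof -
  let ?f = "\<lambda>i::nat. (0::nat,i,0::nat)"
  let ?l = "map ?f (sorted_list_of_set C)"
  have "sorted_wrt (<) (sorted_list_of_set C)" by simp
  then have "sorted ?l"
    unfolding sorted_map by (rule sorted_wrt_mono_rel[rotated]) auto
  moreover have "distinct ?l" by (simp add: distinct_map inj_on_def)
  ultimately have "sorted_list_of_set (set ?l) = ?l"
    by (rule sorted_list_of_set.idem_if_sorted_distinct)
  moreover have "set ?l = xset C" using assms by simp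
  ultimately have "sorted_list_of_set (xset C) = ?l" by simp
  then have "mono (xset C) = wprod (map genel ?l)"
    using mono_eq_wprod[of "xset C"] assms by simp
  moreover have "map genel ?l = map xg (sorted_list_of_set C)" by (simp add: xg_def)
  ultimately show ?thesis by (simp only:)
qed

definition std_index :: "nat \<Rightarrow> nat \<Rightarrow> (nat set \<times> nat) set" where
  "std_index N p = {C. C \<subseteq> {..<N} \<and> card C = p} \<times> {..p}"

definition std_vec :: "nat \<Rightarrow> nat set \<times> nat \<Rightarrow> ext" where
  "std_vec N Ck = bprod N (typed (snd Ck) (sorted_list_of_set (fst Ck)))"

text \<open>The dual functionals to \<open>std_vec\<close>: the coefficient of the x-monomial on C
  in component k. For C \<subseteq> {..<N} this avoids x_N, so \<open>bprod_restrict\<close>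
  applies.\<close>

definition coord :: "nat \<Rightarrow> nat set \<times> nat \<Rightarrow> ext \<Rightarrow> rat" where
  "coord N Ck a = phi (Suc N) a (xset (fst Ck), snd Ck)"

lemma finite_std_index: "finite (std_index N p)"
  unfolding std_index_def by (intro finite_cartesian_product) (auto intro: finite_subset[of _ "Pow {..<N}"])

lemma card_std_index: "card (std_index N p) = (N choose p) * (p + 1)"
  unfolding std_index_def by (simp add: card_cartesian_product n_subsets)

lemma std_monomials_eq: "(\<Union>k\<le>p. std_monomials N 0 p k) = std_vec N ` std_index N p"
proof
  show "(\<Union>k\<le>p. std_monomials N 0 p k) \<subseteq> std_vec N ` std_index N p"
  proof clarify
    fix k x assume k: "k \<le> p" and "x \<in> std_monomials N 0 p k"
    then obtain cs where cs: "x = bprod N (typed k cs)" "sorted_wrt (<) cs" "length cs = p" "set cs \<subseteq> {0..<N}"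
      unfolding std_monomials_def by blast
    have d: "distinct cs" "sorted cs" using cs(2) by (simp_all add: strict_sorted_iff)
    then have "sorted_list_of_set (set cs) = cs" by (simp add: sorted_list_of_set.idem_if_sorted_distinct)
    then have "x = std_vec N (set cs, k)" by (simp add: std_vec_def cs(1))
    moreover have "(set cs, k) \<in> std_index N p" using cs d k by (auto simp: std_index_def distinct_card)
    ultimately show "x \<in> std_vec N ` std_index N p" by blast
  qed
  show "std_vec N ` std_index N p \<subseteq> (\<Union>k\<le>p. std_monomials N 0 p k)"
  proof (rule image_subsetI)
    fix Ck assume "Ck \<in> std_index N p"
    then obtain C k where Ck: "Ck = (C,k)" "C \<subseteq> {..<N}" "card C = p" "k \<le> p" by (auto simp: std_index_def)
    have "finite C" using Ck finite_subset by blast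
    then have "std_vec N Ck \<in> std_monomials N 0 p k"
      unfolding std_monomials_def std_vec_def Ck(1) using Ck
      by (intro CollectI exI[of _ "sorted_list_of_set C"]) auto
    then show "std_vec N Ck \<in> (\<Union>k\<le>p. std_monomials N 0 p k)" using Ck by blast
  qed
qed

lemma coord_std_vec:
  assumes "Ck \<in> std_index N p" "Ck' \<in> std_index N p"
  shows "coord N Ck (std_vec N Ck') = (if Ck = Ck' then 1 else 0)"
proof -
  obtain C k where C: "Ck = (C,k)" "C \<subseteq> {..<N}" using assms(1) by (auto simp: std_index_def)
  obtain C' k' where C': "Ck' = (C',k')" "C' \<subseteq> {..<N}" "card C' = p" "k' \<le> p" using assms(2) by (auto simp: std_index_def)
  have fin: "finite C'" using C' finite_subset by blast
  have "(0,N,0) \<notin> xset C" using C by auto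
  then have "bprod N (map (Pair 0) (sorted_list_of_set C')) (xset C) = mono (xset C') (xset C)"
    unfolding wprod_xg_sorted[OF fin, symmetric] by (rule bprod_restrict)
  moreover have "xset C = xset C' \<longleftrightarrow> C = C'" by (rule inj_image_eq_iff) (simp add: inj_def)
  moreover have "phi (Suc N) (bprod N (typed k' (sorted_list_of_set C'))) (xset C, k) =
      (if k = k' then bprod N (map (Pair 0) (sorted_list_of_set C')) (xset C) else 0)"
    by (rule phi_typed) (use C' fin in auto)
  ultimately show ?thesis unfolding coord_def std_vec_def C(1) C'(1) by (auto simp: mono_def)
qed

section \<open>Kernels and dimensions from dual families\<close>

text \<open>Every vector of the span differs from the sum of its values \<open>lam i\<close> times
  \<open>e i\<close> by an element of J. This is proved without the vanishing hypothesis, which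
  induction over the span would not preserve. No basis of J enters, as the boundaries are known only
  through a spanning family.\<close>

lemma dual_family_kernel:
  assumes J: "qs.subspace J" and I: "finite I"
    and add: "\<And>i a b. lam i (a + b) = lam i a + (lam i b :: rat)"
    and scale: "\<And>i c a. lam i (qscale c a) = c * lam i a"
    and lamJ: "\<And>i a. a \<in> J \<Longrightarrow> lam i a = 0"
    and dual: "\<And>i j. i \<in> I \<Longrightarrow> j \<in> I \<Longrightarrow> lam i (e j) = (if i = j then 1 else 0)"
    and z: "z \<in> qspan (J \<union> e ` I)" "\<And>i. i \<in> I \<Longrightarrow> lam i z = 0"
  shows "z \<in> J"
proof -
  have "z - (\<Sum>i\<in>I. qscale (lam i z) (e i)) \<in> J"
    using z(1)
  proof (induction rule: qs.span_induct_alt)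
    case base
    have "lam i 0 = 0" for i using scale[of i 0 0] by simp
    then have "(\<Sum>i\<in>I. qscale (lam i 0) (e i)) = 0" by (intro sum.neutral) simp
    then show ?case using qs.subspace_0[OF J] by (simp only: diff_zero)
  next
    case (step c x y)
    have *: "x - (\<Sum>i\<in>I. qscale (lam i x) (e i)) \<in> J"
      using step.hyps
    proof
      assume "x \<in> J"
      then show ?thesis using lamJ by simp
    next
      assume "x \<in> e ` I"
      then obtain j where j: "x = e j" "j \<in> I" by blast
      have "(\<Sum>i\<in>I. qscale (lam i x) (e i)) = (\<Sum>i\<in>I. if i = j then e j else 0)"
        by (rule sum.cong) (use j dual in auto)
      then show ?thesis using I j qs.subspace_0[OF J] by simp
    qed
    have "qscale c x + y - (\<Sum>i\<in>I. qscale (lam i (qscale c x + y)) (e i)) =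
      qscale c (x - (\<Sum>i\<in>I. qscale (lam i x) (e i))) + (y - (\<Sum>i\<in>I. qscale (lam i y) (e i)))"
      by (simp only: add scale qs.scale_left_distrib sum.distrib qs.scale_right_diff_distrib
          qs.scale_sum_right qs.scale_scale) (simp only: algebra_simps)
    then show ?case
      using qs.subspace_add[OF J qs.subspace_scale[OF J *] step.IH] by (simp only:)
  qed
  moreover have "(\<Sum>i\<in>I. qscale (lam i z) (e i)) = 0"
    by (rule sum.neutral) (use z(2) in simp)
  ultimately show ?thesis by (simp only: diff_zero)
qed

text \<open>The \<open>e i\<close> are adjoined one at a time to a basis of J: \<open>lam i\<close>
  kills J and the earlier vectors but not \<open>e i\<close>. The finite set T makes the basis of J
  finite, so that cardinalities add.\<close>

lemma dual_family_dim:
  assumes J: "qs.subspace J" "J \<subseteq> qspan T" "finite T" and I: "finite I"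
    and add: "\<And>i a b. lam i (a + b) = lam i a + (lam i b :: rat)"
    and scale: "\<And>i c a. lam i (qscale c a) = c * lam i a"
    and lamJ: "\<And>i a. a \<in> J \<Longrightarrow> lam i a = 0"
    and dual: "\<And>i j. i \<in> I \<Longrightarrow> j \<in> I \<Longrightarrow> lam i (e j) = (if i = j then 1 else 0)"
  shows "qdim (qspan (J \<union> e ` I)) = qdim J + card I"
proof -
  obtain B where B: "B \<subseteq> J" "qs.independent B" "J \<subseteq> qspan B" "card B = qdim J"
    using qs.basis_exists by blast
  have finB: "finite B" using qs.independent_span_bound[OF J(3) B(2)] B(1) J(2) by blast
  have "finite I' \<Longrightarrow> I' \<subseteq> I \<Longrightarrow> qs.independent (B \<union> e ` I') \<and> card (B \<union> e ` I') = card B + card I'" for I'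
  proof (induction I' rule: finite_induct)
    case empty
    have "B \<union> e ` {} = B" by simp
    then show ?case using B(2) by (simp only: card.empty add_0_right simp_thms)
  next
    case (insert i I')
    have sub: "qs.subspace {a. lam i a = 0}"
    proof (rule qs.subspaceI)
      show "0 \<in> {a. lam i a = 0}" using scale[of i 0 0] by simp
    qed (auto simp only: add scale mem_Collect_eq mult_zero_right add_0_right)
    have "B \<union> e ` I' \<subseteq> {a. lam i a = 0}"
      using B(1) lamJ dual insert by auto
    then have "qspan (B \<union> e ` I') \<subseteq> {a. lam i a = 0}" by (rule qs.span_minimal[OF _ sub])
    moreover have "lam i (e i) = 1" using dual insert by auto
    ultimately have ni: "e i \<notin> qspan (B \<union> e ` I')" by auto
    then have "e i \<notin> B \<union> e ` I'" by (rule contrapos_nn) (rule qs.span_base)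
    then have "card (insert (e i) (B \<union> e ` I')) = card B + card (insert i I')"
      using insert finB by simp
    moreover have "qs.independent (insert (e i) (B \<union> e ` I'))"
      by (rule qs.independent_insertI[OF ni]) (use insert in blast)
    moreover have "B \<union> e ` insert i I' = insert (e i) (B \<union> e ` I')" by auto
    ultimately show ?case by (simp only: simp_thms)
  qed
  from this[OF I order_refl] have ind: "qs.independent (B \<union> e ` I)" "card (B \<union> e ` I) = card B + card I"
    by auto
  have "J \<subseteq> qspan (B \<union> e ` I)"
    by (rule order_trans[OF B(3) qs.span_mono]) simp
  moreover have "e ` I \<subseteq> qspan (B \<union> e ` I)"
    by (rule order_trans[OF _ qs.span_superset]) simp
  ultimately have "qspan (J \<union> e ` I) \<subseteq> qspan (B \<union> e ` I)"
    by (intro qs.span_minimal[OF _ qs.subspace_span] Un_least)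
  moreover have "B \<union> e ` I \<subseteq> qspan (J \<union> e ` I)"
    by (rule order_trans[OF _ qs.span_superset]) (use B(1) in blast)
  ultimately have "qdim (qspan (J \<union> e ` I)) = card (B \<union> e ` I)"
    by (intro qs.dim_unique[OF _ _ ind(1) refl])
  then show ?thesis by (simp only: ind(2) B(4))
qed

section \<open>Kernel, dimension and the isomorphism\<close>

lemma coord_lin: "coord N i (a + b) = coord N i a + coord N i b" "coord N i (qscale c a) = c * coord N i a"
  unfolding coord_def using qlin_add[OF qlin_phi] qlin_scale[OF qlin_phi] by simp_all

lemma xy_forms_span: "xy_forms N p = qspan (d_forms N p \<union> std_vec N ` std_index N p)"
proof
  show "xy_forms N p \<subseteq> qspan (d_forms N p \<union> std_vec N ` std_index N p)" using xy_forms_straighten std_monomials_eq by simp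
  have "std_vec N Ck \<in> xy_forms N p" if "Ck \<in> std_index N p" for Ck
  proof -
    obtain C k where Ck: "Ck = (C,k)" "C \<subseteq> {..<N}" "card C = p" using \<open>Ck \<in> std_index N p\<close> by (auto simp: std_index_def)
    then have "finite C" using finite_subset by blast
    then show ?thesis using bprod_in_xy_forms[OF set_typed[of "sorted_list_of_set C" N k]] Ck by (simp add: std_vec_def)
  qed
  then show "qspan (d_forms N p \<union> std_vec N ` std_index N p) \<subseteq> xy_forms N p"
    using d_forms_subset_xy_forms by (intro qs.span_minimal[OF _ subspace_xy_forms]) blast
qed

lemma coord_d_forms: "a \<in> d_forms N p \<Longrightarrow> coord N i a = 0"
  unfolding coord_def by (simp add: phi_d_forms)

lemma phi_kernel: "{a \<in> xy_forms N p. phi (Suc N) a = 0} = d_forms N p"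
proof
  show "d_forms N p \<subseteq> {a \<in> xy_forms N p. phi (Suc N) a = 0}" using d_forms_subset_xy_forms phi_d_forms by blast
  show "{a \<in> xy_forms N p. phi (Suc N) a = 0} \<subseteq> d_forms N p"
  proof clarify
    fix a assume a: "a \<in> xy_forms N p" "phi (Suc N) a = 0"
    show "a \<in> d_forms N p"
    proof (rule dual_family_kernel[OF subspace_d_forms finite_std_index coord_lin(1) coord_lin(2) coord_d_forms coord_std_vec])
      show "a \<in> qspan (d_forms N p \<union> std_vec N ` std_index N p)" using a(1) xy_forms_span by simp
      show "coord N i a = 0" for i by (simp add: coord_def a(2))
    qed
  qed
qed

lemma dim_xy_forms: "qdim (xy_forms N p) = qdim (d_forms N p) + (N choose p) * (p + 1)"
proof -
  \<comment> \<open>A finite family containing the spanning vectors of \<open>d_forms\<close>. For p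
    < 2 the truncated p - 2 makes it larger than that empty family, which is harmless since only an
    inclusion of spans is wanted.\<close>
  let ?T = "(\<lambda>(i,j,l). wedge (domega (2,i,j)) (bprod N l)) `
      ({..N} \<times> {..N} \<times> {l. set l \<subseteq> idx N \<and> length l = p - 2})"
  have "d_forms N p \<subseteq> qspan ?T"
    unfolding d_forms_def by (rule qs.span_mono) (force simp: image_iff)
  moreover have "finite ?T"
    by (intro finite_imageI finite_cartesian_product finite_lists_length_eq) auto
  ultimately have "qdim (qspan (d_forms N p \<union> std_vec N ` std_index N p)) = qdim (d_forms N p) + card (std_index N p)"
    by (rule dual_family_dim[OF subspace_d_forms _ _ finite_std_index coord_lin(1) coord_lin(2) coord_d_forms coord_std_vec])
  then show ?thesis by (simp only: xy_forms_span[symmetric] card_std_index)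
qed

theorem theorem3p9:
  fixes n p :: nat
  assumes "1 \<le> n"
  shows "(\<exists>\<phi> :: ext \<Rightarrow> (gen set \<times> nat \<Rightarrow> rat).
            (\<forall>a\<in>Zc n p 0. \<forall>b\<in>Zc n p 0. \<phi> (a + b) = \<phi> a + \<phi> b)
          \<and> (\<forall>c. \<forall>a\<in>Zc n p 0. \<phi> (qscale c a) = qscale c (\<phi> a))
          \<and> \<phi> ` Zc n p 0 = Tens n p
          \<and> {a \<in> Zc n p 0. \<phi> a = 0} = Bd n p 0
          \<and> (\<forall>\<sigma> g a. \<sigma> permutes {..<n} \<longrightarrow> g \<in> SL2 \<longrightarrow> a \<in> Zc n p 0 \<longrightarrow>
                \<phi> (act n (\<sigma>, g) a) = tact n p (\<sigma>, g) (\<phi> a)))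
       \<and> E3dim n p 0 = (n - 1 choose p) * (p + 1)"
proof -
  \<comment> \<open>N is both the subtracted index and the dimension n - 1 of V. For n = 1 the set
    \<open>idx N\<close> is empty and only p = 0 contributes.\<close>
  obtain N where n: "n = Suc N" using assms by (cases n) auto
  \<comment> \<open>\<open>dim_xy_forms\<close> is additive, so the truncated subtraction in
    \<open>E3dim\<close> is exact.\<close>
  have "E3dim n p 0 = (n - 1 choose p) * (p + 1)"
    unfolding n E3dim_def Zc_eq Bd_eq dim_xy_forms by simp
  moreover have "phi n (act n (\<sigma>, g) a) = tact n p (\<sigma>, g) (phi n a)"
    if "\<sigma> permutes {..<n}" "a \<in> xy_forms N p" for \<sigma> g a
    by (rule phi_act) (use that xy_forms_supp xy_forms_homog n in auto)
  ultimately show ?thesis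
    using qlin_add[OF qlin_phi] qlin_scale[OF qlin_phi] phi_image[of N p] phi_kernel[of N p]
    unfolding n Zc_eq Bd_eq by (intro conjI exI[of _ "phi (Suc N)"]) auto
qed

end
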